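(* Let $\theta=\cot^{-1}\sqrt{15}$. For every integer $k\ge 1$, $$\begin{aligned}\zeta(4k-1)=\;&(2\pi)^{4k-1}\sum_{j=0}^k \frac{(-1)^{j+1}\, c_{jk}\, B_{2j}\, B_{4k-2j}}{(2j)!\,(4k-2j)!}+a_k\,\mathcal{S}_{e^{-\sqrt{15}\pi}}(-4k+1)\\&+\left(2^{-4k+2}+2\right)b_k\,\mathcal{L}_{e^{-\sqrt{15}\pi}}(-4k+1)\\&-\left(2^{-8k+4}+3\times2^{-4k+2}+4\right)b_k\,\mathcal{L}_{e^{-2\sqrt{15}\pi}}(-4k+1)\\&+\left(2^{-8k+4}+2^{-4k+3}\right)b_k\,\mathcal{L}_{e^{-4\sqrt{15}\pi}}(-4k+1),\end{aligned}$$ where $$a_k=\frac{\cos[(4k-1)\theta]-2\sin(4k\theta)}{4\cos^2[(2k-1)\theta]},$$ $$b_k=\frac{2+2\cos(4k\theta)+\sin[(4k-1)\theta]}{4\cos^2[(2k-1)\theta]},$$ $$c_{jk}=\frac{\cos[(2k-2j)\theta]}{(1+\delta_{jk})\cos[(2k-1)\theta]}.$$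
   Context: For complex $q$ with $|q|<1$ and $s\in\mathbb{C}$, the Lambert series is $\mathcal{L}_q(s)=\sum_{n=1}^\infty \frac{n^s q^n}{1-q^n}$. For $0<q<1$ and $s\in\mathbb{C}$, $\mathcal{S}_q(s)= i\left[\mathcal{L}_{i\sqrt{q}}(s)-\mathcal{L}_{-i\sqrt{q}}(s)\right]$, where $i=\sqrt{-1}$ and $\sqrt{q}>0$. $\zeta$ is the Riemann zeta function, $B_m$ is the $m$th Bernoulli number, and $\delta_{jk}$ is the Kronecker delta. $\cot^{-1}\sqrt{15}$ denotes the angle in $(0,\pi/2)$ whose cotangent is $\sqrt{15}$. *)

theory Defs
  imports
    "HOL-Analysis.Analysis"
    "HOL-Computational_Algebra.Formal_Power_Series"
begin

(* In both series the summation index n starts at 0, so Suc n plays the role of n >= 1. *)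

definition lambert_series :: "complex \<Rightarrow> complex \<Rightarrow> complex" where
  "lambert_series q s = (\<Sum>n. of_nat (Suc n) powr s * q ^ Suc n / (1 - q ^ Suc n))"

definition lambert_S :: "real \<Rightarrow> complex \<Rightarrow> complex" where
  "lambert_S q s =
     \<i> * (lambert_series (\<i> * of_real (sqrt q)) s - lambert_series (- \<i> * of_real (sqrt q)) s)"

(* The Riemann zeta function on the half-plane Re s > 1, where it is given by its
   Dirichlet series; outside that half-plane the value is meaningless. *)
definition zeta :: "complex \<Rightarrow> complex" where
  "zeta s = (\<Sum>n. 1 / of_nat (Suc n) powr s)"

(* x / (e^x - 1) = sum of B_m x^m / m!, hence B_1 = -1/2. The divisor has no constant
   term; that the quotient is nevertheless exact is the lemma below. *)
definition bernoulli :: "nat \<Rightarrow> real" where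
  "bernoulli m = fact m * fps_nth (fps_X / (fps_exp 1 - 1)) m"

lemma bernoulli_fps: "Abs_fps (\<lambda>m. bernoulli m / fact m) * (fps_exp 1 - 1) = fps_X"
proof -
  let ?g = "fps_exp 1 - 1 :: real fps"
  have g1: "fps_nth ?g 1 \<noteq> 0" by simp
  then have "?g \<noteq> 0" by (metis fps_zero_nth)
  moreover have "subdegree ?g \<le> subdegree (fps_X :: real fps)"
    using g1 subdegree_leI[of ?g 1] by simp
  ultimately have "fps_X / ?g * ?g = fps_X"
    by (simp add: fps_dvd_iff)
  moreover have "Abs_fps (\<lambda>m. bernoulli m / fact m) = fps_X / ?g"
    by (simp add: fps_eq_iff bernoulli_def)
  ultimately show ?thesis by simp
qed

definition coeff_a :: "real \<Rightarrow> nat \<Rightarrow> real" where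
  "coeff_a \<theta> k =
     (cos ((4 * real k - 1) * \<theta>) - 2 * sin (4 * real k * \<theta>))
       / (4 * (cos ((2 * real k - 1) * \<theta>))\<^sup>2)"

definition coeff_b :: "real \<Rightarrow> nat \<Rightarrow> real" where
  "coeff_b \<theta> k =
     (2 + 2 * cos (4 * real k * \<theta>) + sin ((4 * real k - 1) * \<theta>))
       / (4 * (cos ((2 * real k - 1) * \<theta>))\<^sup>2)"

definition coeff_c :: "real \<Rightarrow> nat \<Rightarrow> nat \<Rightarrow> real" where
  "coeff_c \<theta> j k =
     cos ((2 * real k - 2 * real j) * \<theta>)
       / ((1 + (if j = k then 1 else 0)) * cos ((2 * real k - 1) * \<theta>))"

end

theory Submission
  imports Defs
begin

text \<open>
  Write \<open>G(t) = \<Sum>n\<ge>1. \<pi> cot(\<pi>nt) / n^(2m+1)\<close>. Expanding the cotangent into partial fractions turns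
  \<open>G(t)\<close> and \<open>t^(2m) G(-1/t)\<close> into absolutely convergent double sums over the same denominators
  \<open>n^2 t^2 - k^2\<close>; their difference is a finite geometric sum in which the denominators cancel, so it
  is a Laurent polynomial in \<open>t\<close> whose coefficients are products of even zeta values, that is, of Bernoulli numbers.
  On the other hand \<open>G(t)\<close> is \<open>-i\<pi>(\<zeta>(2m+1) + 2 L(e^(2\<pi>it)))\<close> with \<open>L\<close> the Lambert series at exponent
  \<open>-(2m+1)\<close>.

  The theorem is this identity for \<open>m = 2k - 1\<close> at \<open>t = sin \<theta> + i cos \<theta> = (1 + i \<surd>15)/4\<close>. This point
  lies on the unit circle and satisfies \<open>-1/t = t - 1/2\<close>, so that \<open>e^(2\<pi>it) = y\<close> and
  \<open>e^(2\<pi>i(-1/t)) = -y\<close> with \<open>y = i e^(-\<pi>\<surd>15/2)\<close>. The difference \<open>L(y) - L(-y)\<close> is the series \<open>S\<close>, and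
  \<open>L(y) + L(-y)\<close> reduces to the Lambert series at \<open>q\<close>, \<open>q^2\<close>, \<open>q^4\<close> with \<open>q = e^(-\<pi>\<surd>15)\<close> by
  splitting the summation index by parity. Because \<open>sin \<theta> = 1/4\<close>, the coefficients collapse to
  \<open>b_k = 1\<close> and \<open>a_k = -tan((2k-1)\<theta>)\<close>.
\<close>

section \<open>Partial fractions of the cotangent\<close>

text \<open>This is the logarithmic derivative of Euler's reflection formula
  \<open>Gamma z * Gamma (1 - z) = pi / sin (pi * z)\<close>: both sides are differentiated at
  \<open>z\<close> and compared.\<close>

lemma Digamma_reflection_complex:
  fixes z :: complex
  assumes "z \<notin> \<int>"
  shows "Digamma (1 - z) - Digamma z = pi * cot (pi * z)"
proof -
  have z: "z \<notin> \<int>\<^sub>\<le>\<^sub>0" "1 - z \<notin> \<int>\<^sub>\<le>\<^sub>0"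
    using assms by (auto elim!: nonpos_Ints_cases simp: algebra_simps)
      (metis Ints_1 Ints_diff Ints_of_int diff_diff_eq2 diff_add_cancel add_diff_cancel)+
  have s: "sin (of_real pi * z) \<noteq> 0"
    using assms by (auto simp: sin_eq_0)
  have "((\<lambda>w. Gamma w * Gamma (1 - w)) has_field_derivative
          Gamma z * Gamma (1 - z) * (Digamma z - Digamma (1 - z))) (at z)"
    using z by (auto intro!: derivative_eq_intros simp: algebra_simps)
  moreover have "((\<lambda>w. of_real pi / sin (of_real pi * w)) has_field_derivative
          - of_real pi * (cos (of_real pi * z) * of_real pi) / (sin (of_real pi * z))\<^sup>2) (at z)"
    using s by (auto intro!: derivative_eq_intros simp: power2_eq_square)
  ultimately have "of_real pi / sin (of_real pi * z) * (Digamma z - Digamma (1 - z)) =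
      - of_real pi * (cos (of_real pi * z) * of_real pi) / (sin (of_real pi * z))\<^sup>2"
    unfolding Gamma_reflection_complex by (rule DERIV_unique)
  note eq = this
  have "Digamma z - Digamma (1 - z) =
      of_real pi / sin (of_real pi * z) * (Digamma z - Digamma (1 - z)) * (sin (of_real pi * z) / of_real pi)"
    using s by (simp add: field_simps)
  also have "\<dots> = - (pi * cot (pi * z))"
    unfolding eq using s by (simp add: cot_def power2_eq_square)
  finally show ?thesis by (metis minus_diff_eq minus_minus)
qed

text \<open>\<open>Digamma\<close> is a limit of a logarithm minus a partial sum of reciprocals. In
  the difference at \<open>1 - z\<close> and \<open>z\<close> the logarithms cancel and a series for
  the cotangent remains.\<close>

lemma cot_partial_fractions_complex:
  fixes z :: complex
  assumes "z \<notin> \<int>"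
  shows "(\<lambda>n. 2 * z / (z\<^sup>2 - of_nat (Suc n) ^ 2)) sums (pi * cot (pi * z) - 1 / z)"
proof -
  have nz: "z \<noteq> 0" "1 - z \<noteq> 0" "z + of_nat n \<noteq> 0" "1 - z + of_nat n \<noteq> 0" for n
  proof -
    show "z \<noteq> 0" "1 - z \<noteq> 0" using assms by auto
    show "z + of_nat n \<noteq> 0"
      using assms by (metis Ints_minus Ints_of_nat add_eq_0_iff2)
    show "1 - z + of_nat n \<noteq> 0"
      using assms by (metis Ints_of_nat add.commute add_diff_eq of_nat_Suc right_minus_eq)
  qed
  have "(\<lambda>m. (of_real (ln (real m)) - (\<Sum>n<m. inverse (1 - z + of_nat n))) -
            (of_real (ln (real m)) - (\<Sum>n<m. inverse (z + of_nat n))))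
          \<longlonglongrightarrow> Digamma (1 - z) - Digamma z"
    by (intro tendsto_diff Digamma_LIMSEQ nz)
  then have *: "(\<lambda>n. inverse (z + of_nat n) - inverse (1 - z + of_nat n)) sums (pi * cot (pi * z))"
    by (simp add: sums_def sum_subtractf Digamma_reflection_complex[OF assms])
  \<comment> \<open>The telescoping series shifts one index, so that the poles at
    \<open>n + 1\<close> and \<open>- (n + 1)\<close> share a term; its sum \<open>- 1 / z\<close>
    accounts for the pole at 0.\<close>
  have "(\<lambda>n. inverse (z + of_nat (Suc n)) - inverse (z + of_nat n)) sums (0 - inverse (z + of_nat 0))"
    by (intro telescope_sums filterlim_compose[OF tendsto_inverse_0]
          tendsto_add_filterlim_at_infinity[OF tendsto_const] tendsto_of_nat)
  from sums_add[OF this *]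
  have "(\<lambda>n. inverse (z + of_nat (Suc n)) - inverse (1 - z + of_nat n)) sums
          (pi * cot (pi * z) - 1 / z)"
    by (simp add: field_simps)
  moreover have "inverse (z + of_nat (Suc n)) - inverse (1 - z + of_nat n) =
      2 * z / (z\<^sup>2 - of_nat (Suc n) ^ 2)" for n
  proof -
    have "z\<^sup>2 - of_nat (Suc n) ^ 2 = - ((z + of_nat (Suc n)) * (1 - z + of_nat n))"
      by (simp add: power2_eq_square algebra_simps)
    then show ?thesis
      using nz(3)[of "Suc n"] nz(4)[of n]
      by (simp add: divide_simps)
  qed
  ultimately show ?thesis by simp
qed

section \<open>The transformation formula of the cotangent series\<close>

lemma zeta_of_nat_has_sum:
  assumes "p \<ge> 2"
  shows "((\<lambda>n. 1 / of_nat (Suc n) ^ p) has_sum zeta (of_nat p)) UNIV"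
proof -
  have "summable (\<lambda>n. 1 / real (Suc n) ^ p)"
    using inverse_power_summable[OF assms, where 'a = real]
    by (subst summable_Suc_iff[of "\<lambda>n. 1 / real n ^ p"]) (simp add: field_simps)
  then have "((\<lambda>n. 1 / of_nat (Suc n) ^ p :: complex) has_sum (\<Sum>n. 1 / of_nat (Suc n) ^ p)) UNIV"
    by (intro norm_summable_imp_has_sum summable_sums)
      (auto simp: norm_divide norm_power simp del: of_nat_Suc intro: summable_norm_cancel)
  then show ?thesis
    by (simp add: zeta_def powr_nat' del: of_nat_Suc)
qed

text \<open>The bound is uniform in \<open>n\<close>, so multiplying it by an inverse power of
  \<open>n\<close> yields a summable majorant of product form. The denominator is a difference of
  squares, and each of its two factors is bounded below.\<close>

lemma norm_inverse_lattice_bound: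
  fixes t :: complex
  assumes "Im t \<noteq> 0"
  shows "norm (1 / ((of_nat n * t)\<^sup>2 - of_nat (Suc k) ^ 2)) \<le> (norm t / \<bar>Im t\<bar>)\<^sup>2 / real (Suc k) ^ 2"
proof -
  \<comment> \<open>Since \<open>cnj t * t\<close> is real, multiplying by \<open>cnj t\<close>
    removes \<open>x\<close> from the imaginary part.\<close>
  have *: "\<bar>y\<bar> * \<bar>Im t\<bar> \<le> norm t * norm (of_real x * t - of_real y)" for x y :: real
  proof -
    have "\<bar>y\<bar> * \<bar>Im t\<bar> = \<bar>Im (cnj t * (of_real x * t - of_real y))\<bar>"
      by (simp add: abs_mult algebra_simps)
    also have "\<dots> \<le> norm (cnj t * (of_real x * t - of_real y))"
      by (rule abs_Im_le_cmod)
    finally show ?thesis by (simp add: norm_mult)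
  qed
  have t: "norm t > 0" using assms by auto
  let ?K = "real (Suc k)"
  let ?D = "(of_nat n * t)\<^sup>2 - of_nat (Suc k) ^ 2 :: complex"
  have "(?K * \<bar>Im t\<bar>) * (?K * \<bar>Im t\<bar>) \<le>
      (norm t * norm (of_real (real n) * t - of_real ?K)) *
      (norm t * norm (of_real (real n) * t - of_real (- ?K)))"
    using mult_mono[OF *[of ?K "real n"] *[of "- ?K" "real n"]]
    by (simp only: abs_minus_cancel abs_of_nat) simp
  also have "\<dots> = (norm t)\<^sup>2 * norm ((of_nat n * t - of_nat (Suc k)) * (of_nat n * t + of_nat (Suc k)))"
    by (simp add: norm_mult power2_eq_square del: of_nat_Suc)
  also have "(of_nat n * t - of_nat (Suc k)) * (of_nat n * t + of_nat (Suc k)) = ?D"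
    by (simp only: square_diff_square_factored power2_eq_square mult.commute)
  finally have le: "(?K * \<bar>Im t\<bar>)\<^sup>2 \<le> (norm t)\<^sup>2 * norm ?D"
    by (simp add: power2_eq_square)
  moreover have pos: "0 < (?K * \<bar>Im t\<bar>)\<^sup>2"
    using assms by simp
  ultimately have D: "norm ?D > 0"
    using t by (metis less_le_trans zero_less_mult_pos zero_less_power)
  have "norm (1 / ?D) = 1 / norm ?D"
    by (simp add: norm_divide)
  also have "\<dots> \<le> (norm t)\<^sup>2 / (?K * \<bar>Im t\<bar>)\<^sup>2"
    using le D pos by (simp add: divide_simps mult.commute del: of_nat_Suc)
  also have "\<dots> = (norm t / \<bar>Im t\<bar>)\<^sup>2 / ?K ^ 2"
    by (simp only: power_divide power_mult_distrib power2_abs divide_divide_eq_left mult.commute)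
  finally show ?thesis .
qed

lemma of_nat_mult_notin_Ints:
  fixes t :: complex
  assumes "Im t \<noteq> 0"
  shows "of_nat (Suc n) * t \<notin> \<int>"
proof
  assume "of_nat (Suc n) * t \<in> \<int>"
  then obtain k where "of_nat (Suc n) * t = of_int k"
    by (elim Ints_cases)
  then have "Im (of_nat (Suc n) * t) = Im (of_int k)"
    by (rule arg_cong)
  with assms show False
    by (simp del: of_nat_Suc)
qed

lemma zeta_real_summable:
  assumes "p \<ge> 2"
  shows "(\<lambda>n. 1 / real (Suc n) ^ p) summable_on UNIV"
proof -
  have "(\<lambda>n. 1 / of_nat (Suc n) ^ p :: complex) summable_on UNIV"
    using zeta_of_nat_has_sum[OF assms] has_sum_imp_summable by blast
  then have "(\<lambda>n. complex_of_real (1 / real (Suc n) ^ p)) summable_on UNIV"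
    by (simp del: of_nat_Suc)
  then show ?thesis
    using summable_on_Re by fastforce
qed

lemma summable_on_prod_nonneg:
  fixes f :: "'a \<Rightarrow> real" and g :: "'b \<Rightarrow> real"
  assumes "f summable_on A" "g summable_on B"
  assumes "\<And>x. x \<in> A \<Longrightarrow> f x \<ge> 0" "\<And>y. y \<in> B \<Longrightarrow> g y \<ge> 0"
  shows "(\<lambda>(x, y). f x * g y) summable_on A \<times> B"
proof (rule summable_on_SigmaI)
  show "((\<lambda>y. case (x, y) of (x, y) \<Rightarrow> f x * g y) has_sum f x * infsum g B) B" for x
    using has_sum_cmult_right[OF has_sum_infsum[OF assms(2)]] by simp
  show "(\<lambda>x. f x * infsum g B) summable_on A"
    by (rule summable_on_cmult_left[OF assms(1)])
qed (use assms in auto)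

lemma zeta_product_has_sum:
  assumes "p \<ge> 2" "q \<ge> 2"
  shows "((\<lambda>(n, k). 1 / of_nat (Suc n) ^ p * (1 / of_nat (Suc k) ^ q))
           has_sum (zeta (of_nat p) * zeta (of_nat q))) (UNIV \<times> UNIV)"
proof (rule has_sum_SigmaI)
  show "((\<lambda>k. case (n, k) of (n, k) \<Rightarrow> 1 / of_nat (Suc n) ^ p * (1 / of_nat (Suc k) ^ q))
      has_sum 1 / of_nat (Suc n) ^ p * zeta (of_nat q)) UNIV" for n
    unfolding prod.case by (rule has_sum_cmult_right[OF zeta_of_nat_has_sum[OF assms(2)]])
  show "((\<lambda>n. 1 / of_nat (Suc n) ^ p * zeta (of_nat q)) has_sum zeta (of_nat p) * zeta (of_nat q)) UNIV"
    by (rule has_sum_cmult_left[OF zeta_of_nat_has_sum[OF assms(1)]])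
  show "(\<lambda>(n, k). 1 / of_nat (Suc n) ^ p * (1 / of_nat (Suc k) ^ q) :: complex) summable_on UNIV \<times> UNIV"
  proof (rule abs_summable_summable)
    have "(\<lambda>(n, k). 1 / real (Suc n) ^ p * (1 / real (Suc k) ^ q)) summable_on UNIV \<times> UNIV"
      by (intro summable_on_prod_nonneg zeta_real_summable assms) auto
    moreover have "norm (case x of (n, k) \<Rightarrow> 1 / complex_of_nat (Suc n) ^ p * (1 / complex_of_nat (Suc k) ^ q)) =
        (case x of (n, k) \<Rightarrow> 1 / real (Suc n) ^ p * (1 / real (Suc k) ^ q))" for x
      by (cases x) (simp add: norm_mult norm_divide norm_power del: of_nat_Suc)
    ultimately show "(\<lambda>x. norm (case x of (n, k) \<Rightarrow>
        1 / complex_of_nat (Suc n) ^ p * (1 / complex_of_nat (Suc k) ^ q))) summable_on UNIV \<times> UNIV"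
      by (simp only:)
  qed
qed

text \<open>With \<open>N = Suc n\<close>, this is the partial-fraction term of
  \<open>pi * cot (pi * N * t) / N ^ (2 * m + 1)\<close> for the poles \<open>Suc k\<close> and
  \<open>- Suc k\<close>, divided by the common factor \<open>2 * t\<close>.\<close>

definition lattice_term :: "nat \<Rightarrow> complex \<Rightarrow> nat \<Rightarrow> nat \<Rightarrow> complex" where
  "lattice_term m t n k =
     1 / (of_nat (Suc n) ^ (2 * m) * ((of_nat (Suc n) * t)\<^sup>2 - of_nat (Suc k) ^ 2))"

lemma has_sum_finite_sum:
  fixes f :: "'a \<Rightarrow> 'b \<Rightarrow> 'c :: topological_comm_monoid_add"
  assumes "\<And>j. j \<in> J \<Longrightarrow> (f j has_sum s j) A"
  shows "((\<lambda>x. \<Sum>j\<in>J. f j x) has_sum (\<Sum>j\<in>J. s j)) A"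
  using assms
proof (induction J rule: infinite_finite_induct)
  case (insert j J)
  have "((\<lambda>x. f j x + (\<Sum>i\<in>J. f i x)) has_sum s j + (\<Sum>i\<in>J. s i)) A"
    by (intro has_sum_add insert) auto
  then show ?case
    using insert.hyps by simp
qed simp_all

lemma lattice_term_summable:
  fixes t :: complex
  assumes "Im t \<noteq> 0" "m \<ge> 1"
  shows "(\<lambda>(n, k). lattice_term m t n k) summable_on UNIV \<times> UNIV"
proof -
  let ?c = "(norm t / \<bar>Im t\<bar>)\<^sup>2"
  have "(\<lambda>(n, k). 1 / real (Suc n) ^ (2 * m) * (1 / real (Suc k) ^ 2)) summable_on UNIV \<times> UNIV"
    using assms by (intro summable_on_prod_nonneg zeta_real_summable) auto
  then have S: "(\<lambda>x. ?c * (case x of (n, k) \<Rightarrow> 1 / real (Suc n) ^ (2 * m) * (1 / real (Suc k) ^ 2)))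
      summable_on UNIV \<times> UNIV"
    by (rule summable_on_cmult_right)
  have "(\<lambda>x. norm (case x of (n, k) \<Rightarrow> lattice_term m t n k)) summable_on UNIV \<times> UNIV"
  proof (rule Infinite_Sum.abs_summable_on_comparison_test'[OF S], clarify)
    fix n k
    have "norm (lattice_term m t n k) = 1 / real (Suc n) ^ (2 * m) *
        norm (1 / ((of_nat (Suc n) * t)\<^sup>2 - of_nat (Suc k) ^ 2))"
      by (simp add: lattice_term_def norm_divide norm_mult norm_power del: of_nat_Suc)
    also have "\<dots> \<le> 1 / real (Suc n) ^ (2 * m) * (?c / real (Suc k) ^ 2)"
      by (intro mult_left_mono norm_inverse_lattice_bound assms) auto
    finally show "norm (lattice_term m t n k) \<le>
        ?c * (1 / real (Suc n) ^ (2 * m) * (1 / real (Suc k) ^ 2))"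
      by (simp add: field_simps)
  qed
  then show ?thesis by (rule abs_summable_summable)
qed

text \<open>The cotangent series is encoded through its double series, the form in which rows and
  columns can be exchanged. The first summand collects the contributions of the pole at 0.\<close>

definition cot_series :: "nat \<Rightarrow> complex \<Rightarrow> complex" where
  "cot_series m t = zeta (of_nat (2 * m + 2)) / t
     + 2 * t * infsum (\<lambda>(n, k). lattice_term m t n k) (UNIV \<times> UNIV)"

text \<open>Each row of the double series is summed by the partial fractions at
  \<open>Suc n * t\<close>, which recovers the cotangent.\<close>

lemma cot_series_has_sum:
  fixes t :: complex
  assumes "Im t \<noteq> 0" "m \<ge> 1"
  shows "((\<lambda>n. pi * cot (pi * (of_nat (Suc n) * t)) / of_nat (Suc n) ^ (2 * m + 1))
           has_sum cot_series m t) UNIV"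
proof -
  have t: "t \<noteq> 0" using assms by auto
  define C where "C n = pi * cot (pi * (of_nat (Suc n) * t))" for n
  have inner: "((\<lambda>k. lattice_term m t n k) has_sum
          (C n - 1 / (of_nat (Suc n) * t)) / (2 * (of_nat (Suc n) * t) * of_nat (Suc n) ^ (2 * m))) UNIV"
    for n
  proof -
    let ?z = "of_nat (Suc n) * t"
    have z: "?z \<noteq> 0" using t by (simp del: of_nat_Suc)
    have "summable (\<lambda>k. (norm t / \<bar>Im t\<bar>)\<^sup>2 * (1 / real (Suc k) ^ 2))"
      using zeta_real_summable[of 2] by (intro summable_mult summable_on_imp_summable) auto
    then have "summable (\<lambda>k. norm (1 / (?z\<^sup>2 - of_nat (Suc k) ^ 2)))"
      by (rule summable_comparison_test')
        (use norm_inverse_lattice_bound[OF assms(1), of "Suc n"] in auto)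
    then have "summable (\<lambda>k. norm (2 * ?z) * norm (1 / (?z\<^sup>2 - of_nat (Suc k) ^ 2)))"
      by (rule summable_mult)
    then have "summable (\<lambda>k. norm (2 * ?z / (?z\<^sup>2 - of_nat (Suc k) ^ 2)))"
      by (simp add: norm_divide norm_mult del: of_nat_Suc)
    then have "((\<lambda>k. 2 * ?z / (?z\<^sup>2 - of_nat (Suc k) ^ 2)) has_sum (C n - 1 / ?z)) UNIV"
      unfolding C_def
      by (rule norm_summable_imp_has_sum)
        (rule cot_partial_fractions_complex[OF of_nat_mult_notin_Ints[OF assms(1)]])
    from has_sum_cmult_left[OF this, of "1 / (2 * ?z * of_nat (Suc n) ^ (2 * m))"] show ?thesis
      using z by (simp add: lattice_term_def mult.commute del: of_nat_Suc)
  qed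
  have "((\<lambda>n. (C n - 1 / (of_nat (Suc n) * t)) / (2 * (of_nat (Suc n) * t) * of_nat (Suc n) ^ (2 * m)))
      has_sum infsum (\<lambda>(n, k). lattice_term m t n k) (UNIV \<times> UNIV)) UNIV"
    by (rule has_sum_Sigma'[OF has_sum_infsum[OF lattice_term_summable[OF assms]]])
      (unfold prod.case, rule inner)
  from has_sum_add[OF has_sum_cmult_left[OF zeta_of_nat_has_sum[of "2 * m + 2"], of "1 / t"]
      has_sum_cmult_right[OF this, of "2 * t"]]
  have "((\<lambda>n. 1 / of_nat (Suc n) ^ (2 * m + 2) * (1 / t) + 2 * t *
      ((C n - 1 / (of_nat (Suc n) * t)) / (2 * (of_nat (Suc n) * t) * of_nat (Suc n) ^ (2 * m))))
      has_sum cot_series m t) UNIV"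
    by (simp add: cot_series_def del: of_nat_Suc)
  moreover have "1 / of_nat (Suc n) ^ (2 * m + 2) * (1 / t) + 2 * t *
      ((C n - 1 / (of_nat (Suc n) * t)) / (2 * (of_nat (Suc n) * t) * of_nat (Suc n) ^ (2 * m)))
      = C n / of_nat (Suc n) ^ (2 * m + 1)" for n
  proof -
    have "N \<noteq> 0 \<Longrightarrow> 1 / N ^ (2 * m + 2) * (1 / t) + 2 * t *
      ((C n - 1 / (N * t)) / (2 * (N * t) * N ^ (2 * m))) = C n / N ^ (2 * m + 1)" for N :: complex
      using t by (simp add: field_simps power_add power2_eq_square)
    then show ?thesis by (simp del: of_nat_Suc)
  qed
  ultimately show ?thesis by (simp add: C_def del: of_nat_Suc)
qed

text \<open>Exchanging \<open>n\<close> and \<open>k\<close> while replacing \<open>t\<close> by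
  \<open>- 1 / t\<close> turns the denominator \<open>D\<close> into \<open>- D / t\<^sup>2\<close>.
  Over a common denominator the numerator becomes a difference of \<open>m\<close>-th powers of
  \<open>(N * t)\<^sup>2\<close> and \<open>K\<^sup>2\<close>, which \<open>D\<close> divides; the
  quotient is a geometric sum.\<close>

lemma lattice_term_reciprocity:
  fixes t :: complex
  assumes "Im t \<noteq> 0" "m \<ge> 1"
  shows "lattice_term m t n k + t ^ (2 * m - 2) * lattice_term m (- 1 / t) k n =
     - (\<Sum>j<m. t ^ (2 * j) * (1 / of_nat (Suc n) ^ (2 * m - 2 * j) * (1 / of_nat (Suc k) ^ (2 * j + 2))))"
proof -
  define N K :: complex where "N = of_nat (Suc n)" and "K = of_nat (Suc k)"
  define D where "D = (N * t)\<^sup>2 - K\<^sup>2"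
  have nz: "N \<noteq> 0" "K \<noteq> 0" "t \<noteq> 0"
    using assms by (auto simp: N_def K_def simp del: of_nat_Suc)
  have "D \<noteq> 0"
  proof
    assume "D = 0"
    then have "N * t = K \<or> N * t = - K"
      by (simp add: D_def power2_eq_iff)
    then have "Im (N * t) = Im K \<or> Im (N * t) = Im (- K)"
      by metis
    with assms show False
      by (simp add: N_def K_def del: of_nat_Suc)
  qed
  have "(K * (- 1 / t))\<^sup>2 - N\<^sup>2 = - D / t\<^sup>2"
    using nz by (simp add: D_def field_simps power2_eq_square)
  then have "lattice_term m (- 1 / t) k n = - t\<^sup>2 / (K ^ (2 * m) * D)"
    unfolding lattice_term_def N_def[symmetric] K_def[symmetric] by simp
  \<comment> \<open>Because of truncated subtraction, this rests on
    \<open>m \<ge> 1\<close>.\<close>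
  moreover have "t ^ (2 * m - 2) * t\<^sup>2 = t ^ (2 * m)"
    using assms(2) by (cases m) (simp_all add: power_add power2_eq_square)
  ultimately have "lattice_term m t n k + t ^ (2 * m - 2) * lattice_term m (- 1 / t) k n =
      1 / (N ^ (2 * m) * D) - t ^ (2 * m) / (K ^ (2 * m) * D)"
    unfolding lattice_term_def N_def[symmetric] K_def[symmetric] D_def[symmetric]
    by (simp add: mult.assoc)
  also have "\<dots> = - (((N * t)\<^sup>2) ^ m - (K\<^sup>2) ^ m) / D / (N ^ (2 * m) * K ^ (2 * m))"
    using nz \<open>D \<noteq> 0\<close> by (simp add: power_mult [symmetric] power_mult_distrib divide_simps)
  also have "((N * t)\<^sup>2) ^ m - (K\<^sup>2) ^ m = D * (\<Sum>j<m. (K\<^sup>2) ^ (m - Suc j) * ((N * t)\<^sup>2) ^ j)"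
    unfolding D_def by (rule power_diff_sumr2)
  also have "- (D * (\<Sum>j<m. (K\<^sup>2) ^ (m - Suc j) * ((N * t)\<^sup>2) ^ j)) / D / (N ^ (2 * m) * K ^ (2 * m))
      = - (\<Sum>j<m. (K\<^sup>2) ^ (m - Suc j) * ((N * t)\<^sup>2) ^ j / (N ^ (2 * m) * K ^ (2 * m)))"
    using \<open>D \<noteq> 0\<close> by (simp add: sum_divide_distrib)
  also have "(\<Sum>j<m. (K\<^sup>2) ^ (m - Suc j) * ((N * t)\<^sup>2) ^ j / (N ^ (2 * m) * K ^ (2 * m)))
      = (\<Sum>j<m. t ^ (2 * j) * (1 / N ^ (2 * m - 2 * j) * (1 / K ^ (2 * j + 2))))"
  proof (rule sum.cong)
    fix j assume "j \<in> {..<m}"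
    then have j: "j < m" by simp
    have N: "N ^ (2 * m) = N ^ (2 * m - 2 * j) * N ^ (2 * j)"
      using j by (simp flip: power_add)
    have "2 * m = 2 * (m - Suc j) + (2 * j + 2)"
      using j by simp
    then have K: "K ^ (2 * m) = K ^ (2 * (m - Suc j)) * K ^ (2 * j + 2)"
      by (metis power_add)
    have "(K\<^sup>2) ^ (m - Suc j) * ((N * t)\<^sup>2) ^ j = K ^ (2 * (m - Suc j)) * (N ^ (2 * j) * t ^ (2 * j))"
      by (simp only: power_mult power_mult_distrib)
    moreover have "a * (b * c) / (d * b * (a * e)) = c * (1 / d * (1 / e))"
      if "a \<noteq> 0" "b \<noteq> 0" for a b c d e :: complex
      using that by simp
    ultimately show "(K\<^sup>2) ^ (m - Suc j) * ((N * t)\<^sup>2) ^ j / (N ^ (2 * m) * K ^ (2 * m)) =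
        t ^ (2 * j) * (1 / N ^ (2 * m - 2 * j) * (1 / K ^ (2 * j + 2)))"
      unfolding N K using nz by (metis power_not_zero)
  qed simp
  finally show ?thesis by (simp only: N_def K_def)
qed

text \<open>The reciprocity is summed over all pairs. Absolute convergence permits the exchange of
  rows and columns, and each monomial in \<open>t\<close> acquires a product of two zeta values. The
  terms with \<open>zeta (of_nat (2 * m + 2))\<close> stem from the pole of the cotangent at
  0.\<close>

theorem ramanujan_cot_series:
  fixes t :: complex
  assumes "Im t \<noteq> 0" "m \<ge> 1"
  shows "cot_series m t - t ^ (2 * m) * cot_series m (- 1 / t) =
    zeta (of_nat (2 * m + 2)) * (1 / t + t ^ (2 * m + 1))
    - 2 * (\<Sum>j<m. t ^ (2 * j + 1) * (zeta (of_nat (2 * m - 2 * j)) * zeta (of_nat (2 * j + 2))))"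
proof -
  have t: "t \<noteq> 0" using assms by auto
  have im: "Im (- 1 / t) \<noteq> 0"
    using assms by (auto simp: Im_divide complex_neq_0)
  define H where "H u = infsum (\<lambda>(n, k). lattice_term m u n k) (UNIV \<times> UNIV)" for u
  define S where "S = (\<Sum>j<m. t ^ (2 * j) * (zeta (of_nat (2 * m - 2 * j)) * zeta (of_nat (2 * j + 2))))"
  have 1: "((\<lambda>(n, k). lattice_term m t n k) has_sum H t) (UNIV \<times> UNIV)"
    unfolding H_def by (intro has_sum_infsum lattice_term_summable assms)
  have "((\<lambda>(n, k). lattice_term m (- 1 / t) n k) has_sum H (- 1 / t)) (UNIV \<times> UNIV)"
    unfolding H_def by (intro has_sum_infsum lattice_term_summable assms im)
  then have 2: "((\<lambda>(n, k). lattice_term m (- 1 / t) k n) has_sum H (- 1 / t)) (UNIV \<times> UNIV)"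
    by (subst (asm) has_sum_swap) simp
  have "((\<lambda>x. (case x of (n, k) \<Rightarrow> lattice_term m t n k) +
       t ^ (2 * m - 2) * (case x of (n, k) \<Rightarrow> lattice_term m (- 1 / t) k n)) has_sum
       (H t + t ^ (2 * m - 2) * H (- 1 / t))) (UNIV \<times> UNIV)"
    by (intro has_sum_add has_sum_cmult_right 1 2)
  moreover have "(case x of (n, k) \<Rightarrow> lattice_term m t n k) +
       t ^ (2 * m - 2) * (case x of (n, k) \<Rightarrow> lattice_term m (- 1 / t) k n) =
      - (\<Sum>j<m. t ^ (2 * j) * (case x of (n, k) \<Rightarrow>
       1 / of_nat (Suc n) ^ (2 * m - 2 * j) * (1 / of_nat (Suc k) ^ (2 * j + 2))))" for x
    by (cases x) (simp only: prod.case lattice_term_reciprocity[OF assms])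
  ultimately have "((\<lambda>x. - (\<Sum>j<m. t ^ (2 * j) * (case x of (n, k) \<Rightarrow>
       1 / of_nat (Suc n) ^ (2 * m - 2 * j) * (1 / of_nat (Suc k) ^ (2 * j + 2))))) has_sum
       (H t + t ^ (2 * m - 2) * H (- 1 / t))) (UNIV \<times> UNIV)"
    by (simp only:)
  moreover have "((\<lambda>x. - (\<Sum>j<m. t ^ (2 * j) * (case x of (n, k) \<Rightarrow>
       1 / of_nat (Suc n) ^ (2 * m - 2 * j) * (1 / of_nat (Suc k) ^ (2 * j + 2))))) has_sum - S) (UNIV \<times> UNIV)"
    unfolding S_def
    by (intro has_sum_uminusI has_sum_finite_sum has_sum_cmult_right zeta_product_has_sum) auto
  ultimately have eq: "H t + t ^ (2 * m - 2) * H (- 1 / t) = - S"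
    by (rule has_sum_unique)
  \<comment> \<open>The prefactor \<open>2 * (- 1 / t)\<close> of the second double series turns
    \<open>- t ^ (2 * m)\<close> into \<open>2 * t * t ^ (2 * m - 2)\<close>, the weight that the
    reciprocity requires.\<close>
  have p: "t ^ (2 * m) = t ^ (2 * m - 2) * (t * t)"
    using assms(2) by (cases m) (simp_all add: power_add power2_eq_square)
  have "cot_series m t - t ^ (2 * m) * cot_series m (- 1 / t) =
      zeta (of_nat (2 * m + 2)) * (1 / t + t ^ (2 * m + 1)) + 2 * t * (H t + t ^ (2 * m - 2) * H (- 1 / t))"
    unfolding cot_series_def H_def[symmetric] power_add power_one_right p
    using t by (simp add: field_simps)
  also have "\<dots> = zeta (of_nat (2 * m + 2)) * (1 / t + t ^ (2 * m + 1)) - 2 * (t * S)"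
    unfolding eq by simp
  also have "t * S = (\<Sum>j<m. t ^ (2 * j + 1) * (zeta (of_nat (2 * m - 2 * j)) * zeta (of_nat (2 * j + 2))))"
    unfolding S_def sum_distrib_left by (intro sum.cong) (simp_all add: mult_ac)
  finally show ?thesis .
qed

section \<open>Even zeta values and Bernoulli numbers\<close>

text \<open>Each partial fraction is a geometric series in
  \<open>(z / of_nat (Suc n))\<^sup>2\<close>. The resulting double sum is evaluated by rows, which
  gives the cotangent, and by columns, which gives zeta values.\<close>

lemma cot_zeta_expansion:
  fixes z :: complex
  assumes "norm z < 1" "z \<noteq> 0"
  shows "(\<lambda>j. - 2 * zeta (of_nat (2 * j + 2)) * z ^ (2 * j + 2)) sums (pi * z * cot (pi * z) - 1)"
proof -
  define f where "f = (\<lambda>n j. z ^ (2 * j + 2) / complex_of_nat (Suc n) ^ (2 * j + 2))"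
  have f_eq: "f n j = (z / of_nat (Suc n))\<^sup>2 * ((z / of_nat (Suc n))\<^sup>2) ^ j" for n j
    unfolding f_def by (simp add: power_divide flip: power_mult power_add)
  have r: "norm ((z / of_nat (Suc n))\<^sup>2) \<le> (norm z)\<^sup>2 / real (Suc n) ^ 2"
          "(norm z)\<^sup>2 / real (Suc n) ^ 2 \<le> (norm z)\<^sup>2" "(norm z)\<^sup>2 < 1" for n
  proof -
    show "norm ((z / of_nat (Suc n))\<^sup>2) \<le> (norm z)\<^sup>2 / real (Suc n) ^ 2"
      by (simp add: norm_power norm_divide power_divide del: of_nat_Suc)
    show "(norm z)\<^sup>2 / real (Suc n) ^ 2 \<le> (norm z)\<^sup>2"
      by (simp add: divide_le_eq mult_le_cancel_left1)
    show "(norm z)\<^sup>2 < 1"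
      using assms by (simp add: power_less_one_iff)
  qed
  have zint: "z \<notin> \<int>"
    using assms by (auto elim!: Ints_cases)
  \<comment> \<open>One factor \<open>(z / of_nat (Suc n))\<^sup>2\<close> keeps the decay in
    \<open>n\<close>; the other \<open>j\<close> factors are bounded by
    \<open>(norm z)\<^sup>2\<close>.\<close>
  have bound: "norm (f n j) \<le> 1 / real (Suc n) ^ 2 * ((norm z)\<^sup>2) ^ j" for n j
  proof -
    have "norm (f n j) = norm ((z / of_nat (Suc n))\<^sup>2) * norm ((z / of_nat (Suc n))\<^sup>2) ^ j"
      unfolding f_eq norm_mult by (simp only: norm_power)
    also have "\<dots> \<le> (1 / real (Suc n) ^ 2) * ((norm z)\<^sup>2) ^ j"
    proof (intro mult_mono power_mono)
      show "norm ((z / of_nat (Suc n))\<^sup>2) \<le> 1 / real (Suc n) ^ 2"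
        using r(1)[of n] r(3) by (smt (verit) divide_right_mono zero_le_power2)
      show "norm ((z / of_nat (Suc n))\<^sup>2) \<le> (norm z)\<^sup>2"
        using r(1,2)[of n] by linarith
    qed auto
    finally show ?thesis .
  qed
  have "((\<lambda>j. ((norm z)\<^sup>2) ^ j) has_sum 1 / (1 - (norm z)\<^sup>2)) UNIV"
    using r(3) by (intro norm_summable_imp_has_sum geometric_sums) (auto simp: summable_geometric)
  then have S: "(\<lambda>(n, j). 1 / real (Suc n) ^ 2 * ((norm z)\<^sup>2) ^ j) summable_on UNIV \<times> UNIV"
    by (intro summable_on_prod_nonneg zeta_real_summable) (auto simp: has_sum_imp_summable)
  have "(\<lambda>x. norm (case x of (n, j) \<Rightarrow> f n j)) summable_on UNIV \<times> UNIV"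
    by (rule Infinite_Sum.abs_summable_on_comparison_test'[OF S]) (simp only: split_paired_all prod.case bound)
  then have sm: "(\<lambda>(n, j). f n j) summable_on UNIV \<times> UNIV"
    by (rule abs_summable_summable)
  have inner: "((\<lambda>j. f n j) has_sum - (z\<^sup>2 / (z\<^sup>2 - of_nat (Suc n) ^ 2))) UNIV" for n
  proof -
    have lt: "norm ((z / of_nat (Suc n))\<^sup>2) < 1"
      using r(1,2)[of n] r(3) by linarith
    then have "((\<lambda>j. ((z / of_nat (Suc n))\<^sup>2) ^ j) has_sum 1 / (1 - (z / of_nat (Suc n))\<^sup>2)) UNIV"
      by (intro norm_summable_imp_has_sum geometric_sums) (auto simp: norm_power summable_geometric)
    from has_sum_cmult_right[OF this, of "(z / of_nat (Suc n))\<^sup>2"]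
    have "((\<lambda>j. f n j) has_sum (z / of_nat (Suc n))\<^sup>2 * (1 / (1 - (z / of_nat (Suc n))\<^sup>2))) UNIV"
      unfolding f_eq .
    moreover have "(z / N)\<^sup>2 * (1 / (1 - (z / N)\<^sup>2)) = - (z\<^sup>2 / (z\<^sup>2 - N\<^sup>2))"
      if "N \<noteq> 0" "norm ((z / N)\<^sup>2) < 1" for N
    proof -
      have "z\<^sup>2 - N\<^sup>2 \<noteq> 0"
        using that by (auto simp: power_divide)
      moreover have "1 - (z / N)\<^sup>2 = - (z\<^sup>2 - N\<^sup>2) / N\<^sup>2"
        using that by (simp add: field_simps)
      ultimately have "(z / N)\<^sup>2 * (1 / (1 - (z / N)\<^sup>2)) = z\<^sup>2 / (- (z\<^sup>2 - N\<^sup>2))"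
        using that by (simp add: power_divide)
      then show ?thesis by (simp only: divide_minus_right)
    qed
    ultimately show ?thesis using lt by (simp del: of_nat_Suc)
  qed
  from has_sum_infsum[OF sm]
  have a: "((\<lambda>n. - (z\<^sup>2 / (z\<^sup>2 - of_nat (Suc n) ^ 2))) has_sum infsum (\<lambda>(n, j). f n j) (UNIV \<times> UNIV)) UNIV"
    by (rule has_sum_Sigma') (unfold prod.case, rule inner)
  have "(\<lambda>n. - (z / 2) * (2 * z / (z\<^sup>2 - of_nat (Suc n) ^ 2))) sums (- (z / 2) * (pi * cot (pi * z) - 1 / z))"
    by (intro sums_mult cot_partial_fractions_complex zint)
  moreover have "- (z / 2) * (2 * z / (z\<^sup>2 - of_nat (Suc n) ^ 2)) = - (z\<^sup>2 / (z\<^sup>2 - of_nat (Suc n) ^ 2))" for n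
    by (simp add: power2_eq_square)
  ultimately have total: "infsum (\<lambda>(n, j). f n j) (UNIV \<times> UNIV) = - (z / 2) * (pi * cot (pi * z) - 1 / z)"
    using has_sum_imp_sums[OF a] by (metis (no_types, lifting) sums_cong sums_unique2)
  have col: "((\<lambda>n. f n j) has_sum zeta (of_nat (2 * j + 2)) * z ^ (2 * j + 2)) UNIV" for j
    using has_sum_cmult_left[OF zeta_of_nat_has_sum[of "2 * j + 2"], of "z ^ (2 * j + 2)"]
    unfolding f_def by (simp del: of_nat_Suc)
  have "((\<lambda>(j, n). f n j) has_sum infsum (\<lambda>(n, j). f n j) (UNIV \<times> UNIV)) (UNIV \<times> UNIV)"
    using has_sum_infsum[OF sm] by (subst (asm) has_sum_swap) simp
  then have "((\<lambda>j. zeta (of_nat (2 * j + 2)) * z ^ (2 * j + 2)) has_sum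
      infsum (\<lambda>(n, j). f n j) (UNIV \<times> UNIV)) UNIV"
    by (rule has_sum_Sigma') (unfold prod.case, rule col)
  then have "(\<lambda>j. zeta (of_nat (2 * j + 2)) * z ^ (2 * j + 2)) sums (- (z / 2) * (pi * cot (pi * z) - 1 / z))"
    unfolding total by (rule has_sum_imp_sums)
  from sums_mult[OF this, of "- 2"] show ?thesis
    using assms(2) by (simp add: algebra_simps)
qed

lemma cot_eq_exp:
  fixes z :: complex
  assumes "exp (2 * \<i> * z) \<noteq> 1"
  shows "cot z = \<i> * (exp (2 * \<i> * z) + 1) / (exp (2 * \<i> * z) - 1)"
proof -
  define E where "E = exp (\<i> * z)"
  have E: "exp (2 * \<i> * z) = E\<^sup>2" "E \<noteq> 0" "exp (- (\<i> * z)) = 1 / E"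
    unfolding E_def by (simp_all add: exp_double [symmetric] exp_minus field_simps)
  have "E\<^sup>2 - 1 \<noteq> 0" using assms E by simp
  have "cos z = (E\<^sup>2 + 1) / (2 * E)"
    using E(2) by (simp add: cos_exp_eq E(3) E_def[symmetric] field_simps power2_eq_square)
  moreover have "sin z = (E\<^sup>2 - 1) / (2 * \<i> * E)"
    using E(2) by (simp add: sin_exp_eq E(3) E_def[symmetric] field_simps power2_eq_square)
  ultimately show ?thesis
    using E \<open>E\<^sup>2 - 1 \<noteq> 0\<close> by (simp add: cot_def E(1))
qed

text \<open>The \<open>E j\<close> are the Taylor coefficients of the even function
  \<open>(w / 2) * coth (w / 2)\<close>, by the cotangent expansion at
  \<open>w / (2 * pi * \<i>)\<close>. Subtracting \<open>w / 2\<close> leaves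
  \<open>w / (exp w - 1)\<close>, the generating function of the Bernoulli numbers, and affects only
  the coefficient of index 1.\<close>

lemma cot_coeff_eq_bernoulli:
  fixes E :: "nat \<Rightarrow> complex"
  defines "E \<equiv> (\<lambda>j. if j = 0 then 1 else - 2 * zeta (of_nat (2 * j)) / (2 * pi * \<i>) ^ (2 * j))"
  shows "E j = of_real (bernoulli (2 * j) / fact (2 * j))"
proof -
  define e :: "complex \<Rightarrow> complex" where
    "e w = (if w = 0 then 1 else w / 2 * (exp w + 1) / (exp w - 1))" for w
  define F where "F = Abs_fps (\<lambda>n. if even n then E (n div 2) else 0)"
  \<comment> \<open>The zeros of \<open>exp w - 1\<close> are the integer multiples of
    \<open>2 * pi * \<i>\<close>; all but 0 lie outside the unit disc.\<close>
  have small: "exp w \<noteq> 1" if "norm w < 1" "w \<noteq> 0" for w :: complex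
  proof
    assume "exp w = 1"
    then obtain n :: int where n: "Re w = 0" "Im w = of_int (2 * n) * pi"
      by (auto simp: exp_eq_1)
    then have "n \<noteq> 0" using that by (auto simp: complex_eq_iff)
    then have "1 \<le> \<bar>of_int n :: real\<bar>" by linarith
    then have "1 < 2 * \<bar>of_int n\<bar> * pi" using pi_gt3 by (smt (verit) mult_le_cancel_left1 mult_less_cancel_right1)
    also have "\<dots> = \<bar>Im w\<bar>" by (simp add: n abs_mult)
    also have "\<dots> \<le> norm w" by (rule abs_Im_le_cmod)
    finally show False using that by simp
  qed
  have sums: "(\<lambda>n. fps_nth F n * w ^ n) sums e w" if w: "norm w < 1" for w
  proof (cases "w = 0")
    case True
    then show ?thesis
      using powser_sums_zero[of "fps_nth F"] by (simp add: F_def E_def e_def)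
  next
    case False
    define z where "z = w / (2 * pi * \<i>)"
    have z: "norm z < 1" "z \<noteq> 0"
      using w False pi_gt3 by (auto simp: z_def norm_divide norm_mult divide_simps)
    have ez: "2 * \<i> * (pi * z) = w"
      by (simp add: z_def)
    have "pi * z * cot (pi * z) = pi * z * (\<i> * (exp w + 1) / (exp w - 1))"
      using cot_eq_exp[of "pi * z"] small[OF w False] by (simp add: ez)
    also have "\<dots> = (2 * \<i> * (pi * z)) / 2 * (exp w + 1) / (exp w - 1)"
      by simp
    also have "\<dots> = e w"
      unfolding ez using False by (simp add: e_def)
    finally have "(\<lambda>j. - 2 * zeta (of_nat (2 * j + 2)) * z ^ (2 * j + 2)) sums (e w - 1)"
      using cot_zeta_expansion[OF z] by simp
    then have "(\<lambda>j. E (Suc j) * w ^ (2 * Suc j)) sums (e w - 1)"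
      by (simp add: E_def z_def power_divide mult_ac)
    then have "(\<lambda>j. E j * w ^ (2 * j)) sums (e w)"
      by (subst (asm) sums_Suc_iff) (simp add: E_def)
    moreover have "E j * w ^ (2 * j) = fps_nth F (2 * j) * w ^ (2 * j)" for j
      by (simp add: F_def)
    ultimately have "(\<lambda>j. fps_nth F (2 * j) * w ^ (2 * j)) sums (e w)"
      by simp
    moreover have "fps_nth F n * w ^ n = 0" if "n \<notin> range ((*) 2)" for n
      using that by (auto simp: F_def elim!: evenE)
    moreover have "strict_mono ((*) (2::nat))"
      by (simp add: strict_mono_def)
    ultimately show ?thesis
      using sums_mono_reindex[of "(*) 2" "\<lambda>n. fps_nth F n * w ^ n"] by simp
  qed
  have ev: "eventually (\<lambda>w::complex. norm w < 1) (nhds 0)"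
    using eventually_nhds_metric[of "\<lambda>w::complex. norm w < 1" 0] by (auto intro: exI[of _ 1])
  have "e has_fps_expansion F"
    by (rule has_fps_expansionI) (use ev sums in \<open>auto elim: eventually_mono\<close>)
  then have "(\<lambda>w. (e w - 1 / 2 * w) * (exp w - 1)) has_fps_expansion
      (F - fps_const (1 / 2) * fps_X) * (fps_exp 1 - 1)"
    by (intro fps_expansion_intros)
  moreover have "eventually (\<lambda>w. (e w - 1 / 2 * w) * (exp w - 1) = w) (nhds 0)"
    using ev
  proof eventually_elim
    case (elim w)
    then show ?case
      using small[of w] by (cases "w = 0") (simp_all add: e_def field_simps)
  qed
  ultimately have id: "(\<lambda>w. w) has_fps_expansion (F - fps_const (1 / 2) * fps_X) * (fps_exp 1 - 1)"
    unfolding has_fps_expansion_def by (auto elim: eventually_elim2)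
  then have F: "(F - fps_const (1 / 2) * fps_X) * (fps_exp 1 - 1) = fps_X"
    by (intro fps_ext)
      (simp only: fps_nth_fps_expansion[OF id] fps_nth_fps_expansion[OF has_fps_expansion_fps_X])
  define B :: "complex fps" where "B = Abs_fps (\<lambda>m. of_real (bernoulli m / fact m))"
  \<comment> \<open>Embedding the coefficients carries the real identity
    \<open>bernoulli_fps\<close> over to complex power series.\<close>
  have "fps_nth (B * (fps_exp 1 - 1)) n = of_real (fps_nth (Abs_fps (\<lambda>m. bernoulli m / fact m) * (fps_exp 1 - 1)) n)" for n
    by (auto simp: B_def fps_mult_nth intro!: sum.cong)
  then have "B * (fps_exp 1 - 1) = fps_X"
    unfolding bernoulli_fps by (simp add: fps_eq_iff fps_X_def)
  with F have "(F - fps_const (1 / 2) * fps_X) * (fps_exp 1 - 1) = B * (fps_exp 1 - 1)"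
    by simp
  moreover have "fps_nth (fps_exp 1 - 1 :: complex fps) 1 \<noteq> 0"
    by simp
  then have "fps_exp 1 - 1 \<noteq> (0 :: complex fps)"
    by (metis fps_zero_nth)
  ultimately have "F - fps_const (1 / 2) * fps_X = B"
    by simp
  then have "fps_nth (F - fps_const (1 / 2) * fps_X) (2 * j) = fps_nth B (2 * j)"
    by simp
  then show ?thesis
    by (cases j) (simp_all add: F_def B_def fps_const_def)
qed

lemma bernoulli_0: "bernoulli 0 = 1"
  using cot_coeff_eq_bernoulli[of 0] by simp

text \<open>Euler's formula. The usual sign is kept inside the power of \<open>\<i>\<close>, so that
  a product of two such values has a single power of \<open>2 * pi * \<i>\<close>.\<close>

lemma zeta_even_bernoulli:
  assumes "j \<ge> 1"
  shows "zeta (of_nat (2 * j)) = - ((2 * pi * \<i>) ^ (2 * j)) / 2 * of_real (bernoulli (2 * j) / fact (2 * j))"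
  unfolding cot_coeff_eq_bernoulli[of j, symmetric] using assms by (simp add: field_simps)

text \<open>The factor \<open>t\<close> leaves only even powers. As \<open>b 0 = 1\<close>, the two
  boundary terms fit the pattern of the interior products and become the summands
  \<open>i = 0\<close> and \<open>i = m + 1\<close>.\<close>

lemma ramanujan_bernoulli:
  fixes t :: complex and b :: "nat \<Rightarrow> complex"
  defines "b \<equiv> (\<lambda>j. of_real (bernoulli (2 * j) / fact (2 * j)))"
  assumes "Im t \<noteq> 0" "m \<ge> 1"
  shows "t * (cot_series m t - t ^ (2 * m) * cot_series m (- 1 / t)) =
    - ((2 * pi * \<i>) ^ (2 * m + 2)) / 2 * (\<Sum>i\<le>m + 1. b i * b (m + 1 - i) * t ^ (2 * i))"
proof -
  define c where "c = 2 * pi * \<i>"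
  have z: "zeta (of_nat (2 * j)) = - (c ^ (2 * j)) / 2 * b j" if "j \<ge> 1" for j
    using zeta_even_bernoulli[OF that] by (simp add: c_def b_def)
  have b0: "b 0 = 1"
    by (simp add: b_def bernoulli_0)
  have t: "t \<noteq> 0"
    using assms by auto
  have z1: "zeta (of_nat (2 * m + 2)) = - (c ^ (2 * m + 2)) / 2 * b (m + 1)"
    using z[of "m + 1"] by simp
  have z2: "zeta (of_nat (2 * m - 2 * j)) * zeta (of_nat (2 * j + 2)) = c ^ (2 * m + 2) / 4 * (b (m - j) * b (j + 1))"
    if "j < m" for j
  proof -
    have "zeta (of_nat (2 * m - 2 * j)) * zeta (of_nat (2 * j + 2)) =
        (- (c ^ (2 * (m - j))) / 2 * b (m - j)) * (- (c ^ (2 * (j + 1))) / 2 * b (j + 1))"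
      using z[of "m - j"] z[of "j + 1"] that by (simp add: diff_mult_distrib2)
    also have "\<dots> = c ^ (2 * (m - j) + 2 * (j + 1)) / 4 * (b (m - j) * b (j + 1))"
      by (simp add: power_add)
    also have "2 * (m - j) + 2 * (j + 1) = 2 * m + 2"
      using that by simp
    finally show ?thesis .
  qed
  have "t * (cot_series m t - t ^ (2 * m) * cot_series m (- 1 / t)) =
      zeta (of_nat (2 * m + 2)) * (1 + t ^ (2 * m + 2))
      - 2 * (\<Sum>j<m. t ^ (2 * j + 2) * (zeta (of_nat (2 * m - 2 * j)) * zeta (of_nat (2 * j + 2))))"
    unfolding ramanujan_cot_series[OF assms(2,3)] using t
    by (simp add: algebra_simps sum_distrib_left)
  also have "(\<Sum>j<m. t ^ (2 * j + 2) * (zeta (of_nat (2 * m - 2 * j)) * zeta (of_nat (2 * j + 2)))) =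
      c ^ (2 * m + 2) / 4 * (\<Sum>j<m. b (Suc j) * b (m + 1 - Suc j) * t ^ (2 * Suc j))"
    unfolding sum_distrib_left by (intro sum.cong) (simp_all only: z2 lessThan_iff, simp add: mult_ac)
  also have "zeta (of_nat (2 * m + 2)) * (1 + t ^ (2 * m + 2)) -
      2 * (c ^ (2 * m + 2) / 4 * (\<Sum>j<m. b (Suc j) * b (m + 1 - Suc j) * t ^ (2 * Suc j))) =
      - (c ^ (2 * m + 2)) / 2 * (b (m + 1) + (\<Sum>j<m. b (Suc j) * b (m + 1 - Suc j) * t ^ (2 * Suc j))
         + b (m + 1) * t ^ (2 * (m + 1)))"
    unfolding z1 by (simp add: algebra_simps)
  also have "b (m + 1) + (\<Sum>j<m. b (Suc j) * b (m + 1 - Suc j) * t ^ (2 * Suc j)) + b (m + 1) * t ^ (2 * (m + 1))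
      = (\<Sum>i\<le>m + 1. b i * b (m + 1 - i) * t ^ (2 * i))"
  proof -
    let ?g = "\<lambda>i. b i * b (m + 1 - i) * t ^ (2 * i)"
    have "(\<Sum>i\<le>m. ?g i) = ?g 0 + (\<Sum>j<m. ?g (Suc j))"
      by (simp only: lessThan_Suc_atMost [symmetric] sum.lessThan_Suc_shift)
    then show ?thesis by (simp add: b0)
  qed
  finally show ?thesis unfolding c_def .
qed

section \<open>Lambert series\<close>

text \<open>A geometric series is a majorant, since \<open>norm (1 - q ^ N) \<ge> 1 - norm q\<close>
  and \<open>N ^ p \<ge> 1\<close> for \<open>N = Suc n\<close>.\<close>

lemma lambert_series_has_sum:
  assumes "norm q < 1"
  shows "((\<lambda>n. q ^ Suc n / (1 - q ^ Suc n) / of_nat (Suc n) ^ p) has_sum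
           lambert_series q (- of_nat p)) UNIV"
proof -
  have eq: "of_nat (Suc n) powr (- of_nat p) * q ^ Suc n / (1 - q ^ Suc n)
      = q ^ Suc n / (1 - q ^ Suc n) / of_nat (Suc n) ^ p" for n
    by (simp add: powr_minus powr_nat' field_simps del: of_nat_Suc power_Suc)
  have bound: "norm (q ^ Suc n / (1 - q ^ Suc n) / of_nat (Suc n) ^ p) \<le>
      norm q ^ Suc n / (1 - norm q)" for n
  proof -
    have "norm q ^ Suc n \<le> norm q ^ 1"
      using assms by (intro power_decreasing) auto
    moreover have "1 - norm (q ^ Suc n) \<le> norm (1 - q ^ Suc n)"
      using norm_triangle_ineq2[of 1 "q ^ Suc n"] by simp
    ultimately have "norm (q ^ Suc n / (1 - q ^ Suc n)) \<le> norm q ^ Suc n / (1 - norm q)"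
      unfolding norm_divide norm_power using assms
      by (intro divide_left_mono frac_le) (auto simp: norm_power)
    moreover have "norm (q ^ Suc n / (1 - q ^ Suc n) / of_nat (Suc n) ^ p)
        \<le> norm (q ^ Suc n / (1 - q ^ Suc n)) / 1"
      unfolding norm_divide[of _ "of_nat (Suc n) ^ p"] norm_power norm_of_nat
      by (intro divide_left_mono) auto
    ultimately show ?thesis by simp
  qed
  have "summable (\<lambda>n. norm (q ^ Suc n / (1 - q ^ Suc n) / of_nat (Suc n) ^ p))"
  proof (rule summable_comparison_test')
    show "summable (\<lambda>n. norm q ^ Suc n / (1 - norm q))"
      using assms by (intro summable_divide) (simp add: summable_geometric summable_mult)
  qed (use bound in auto)
  then show ?thesis
    unfolding lambert_series_def eq
    by (intro norm_summable_imp_has_sum summable_sums) (auto intro: summable_norm_cancel)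
qed

text \<open>For \<open>t\<close> in the upper half-plane,
  \<open>y = exp (2 * \<i> * (pi * t))\<close> lies in the unit disc and
  \<open>cot (pi * N * t) = - \<i> * (1 + 2 * y ^ N / (1 - y ^ N))\<close>. The constant 1 sums to
  the zeta value, the rest to the Lambert series.\<close>

lemma cot_series_eq_lambert_series:
  fixes t :: complex
  assumes "Im t > 0" "m \<ge> 1"
  shows "cot_series m t = - \<i> * pi * (zeta (of_nat (2 * m + 1))
           + 2 * lambert_series (exp (2 * \<i> * (pi * t))) (- of_nat (2 * m + 1)))"
proof -
  define y where "y = exp (2 * \<i> * (pi * t))"
  have y: "norm y < 1"
    using assms by (simp add: y_def norm_exp_eq_Re)
  have "((\<lambda>n. - \<i> * pi * (1 / of_nat (Suc n) ^ (2 * m + 1) + 2 * (y ^ Suc n / (1 - y ^ Suc n) / of_nat (Suc n) ^ (2 * m + 1))))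
     has_sum (- \<i> * pi * (zeta (of_nat (2 * m + 1)) + 2 * lambert_series y (- of_nat (2 * m + 1))))) UNIV"
    using assms y by (intro has_sum_cmult_right has_sum_add zeta_of_nat_has_sum lambert_series_has_sum) auto
  moreover have "- \<i> * pi * (1 / of_nat (Suc n) ^ (2 * m + 1) + 2 * (y ^ Suc n / (1 - y ^ Suc n) / of_nat (Suc n) ^ (2 * m + 1)))
     = pi * cot (pi * (of_nat (Suc n) * t)) / of_nat (Suc n) ^ (2 * m + 1)" for n
  proof -
    define Y where "Y = y ^ Suc n"
    have Y: "exp (2 * \<i> * (pi * (of_nat (Suc n) * t))) = Y"
      unfolding Y_def y_def exp_of_nat_mult[symmetric] by (simp add: mult_ac del: of_nat_Suc)
    have "norm Y < 1"
      unfolding Y_def norm_power using y by (simp add: power_less_one_iff del: power_Suc)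
    then have "Y \<noteq> 1" by auto
    then have "cot (pi * (of_nat (Suc n) * t)) = \<i> * (Y + 1) / (Y - 1)"
      using cot_eq_exp[of "pi * (of_nat (Suc n) * t)"] unfolding Y by simp
    also have "\<dots> = - \<i> * (1 + 2 * (Y / (1 - Y)))"
      using \<open>Y \<noteq> 1\<close> by (simp add: divide_simps) (simp add: algebra_simps)
    finally have cot_eq: "cot (pi * (of_nat (Suc n) * t)) = - \<i> * (1 + 2 * (Y / (1 - Y)))" .
    have "- \<i> * pi * (1 / P + 2 * (Q / P)) = pi * (- \<i> * (1 + 2 * Q)) / P" for P Q :: complex
      by (cases "P = 0") (simp_all add: field_simps)
    then show ?thesis
      unfolding Y_def[symmetric] cot_eq by blast
  qed
  ultimately have "((\<lambda>n. pi * cot (pi * (of_nat (Suc n) * t)) / of_nat (Suc n) ^ (2 * m + 1))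
     has_sum (- \<i> * pi * (zeta (of_nat (2 * m + 1)) + 2 * lambert_series y (- of_nat (2 * m + 1))))) UNIV"
    by (simp only:)
  moreover have "((\<lambda>n. pi * cot (pi * (of_nat (Suc n) * t)) / of_nat (Suc n) ^ (2 * m + 1))
           has_sum cot_series m t) UNIV"
    using assms by (intro cot_series_has_sum) auto
  ultimately show ?thesis
    unfolding y_def using has_sum_unique by blast
qed

text \<open>An odd \<open>n\<close> belongs to the even exponent \<open>Suc n = 2 * Suc k\<close>:
  the power of \<open>y\<close> becomes one of \<open>y\<^sup>2\<close>, and \<open>2 ^ p\<close>
  comes out of the denominator.\<close>

lemma lambert_series_odd_indices:
  assumes "norm y < 1"
  shows "((\<lambda>n. y ^ Suc n / (1 - y ^ Suc n) / of_nat (Suc n) ^ p) has_sum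
           lambert_series (y\<^sup>2) (- of_nat p) / 2 ^ p) {n. odd n}"
proof -
  have "norm (y\<^sup>2) < 1"
    using assms by (simp add: norm_power power_less_one_iff)
  from has_sum_cmult_left[OF lambert_series_has_sum[OF this, of p], of "1 / 2 ^ p"]
  have "((\<lambda>k. (y\<^sup>2) ^ Suc k / (1 - (y\<^sup>2) ^ Suc k) / of_nat (Suc k) ^ p * (1 / 2 ^ p)) has_sum
      lambert_series (y\<^sup>2) (- of_nat p) / 2 ^ p) UNIV"
    by simp
  moreover have "(y\<^sup>2) ^ Suc k / (1 - (y\<^sup>2) ^ Suc k) / of_nat (Suc k) ^ p * (1 / 2 ^ p) =
      y ^ Suc (2 * k + 1) / (1 - y ^ Suc (2 * k + 1)) / of_nat (Suc (2 * k + 1)) ^ p" for k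
  proof -
    have "Suc (2 * k + 1) = 2 * Suc k" by simp
    then show ?thesis
      unfolding power_mult [symmetric] by (simp only: of_nat_mult power_mult_distrib) (simp add: mult.commute)
  qed
  ultimately have "(((\<lambda>n. y ^ Suc n / (1 - y ^ Suc n) / of_nat (Suc n) ^ p) \<circ> (\<lambda>k. 2 * k + 1)) has_sum
      lambert_series (y\<^sup>2) (- of_nat p) / 2 ^ p) UNIV"
    by (simp only: o_def)
  then have "((\<lambda>n. y ^ Suc n / (1 - y ^ Suc n) / of_nat (Suc n) ^ p) has_sum
      lambert_series (y\<^sup>2) (- of_nat p) / 2 ^ p) (range (\<lambda>k. 2 * k + 1))"
    by (subst has_sum_reindex) (auto simp: inj_on_def)
  moreover have "range (\<lambda>k::nat. 2 * k + 1) = {n. odd n}"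
    by (auto elim!: oddE)
  ultimately show ?thesis by simp
qed

lemma lambert_series_even_indices:
  assumes "norm y < 1"
  shows "((\<lambda>n. y ^ Suc n / (1 - y ^ Suc n) / of_nat (Suc n) ^ p) has_sum
           (lambert_series y (- of_nat p) - lambert_series (y\<^sup>2) (- of_nat p) / 2 ^ p)) {n. even n}"
proof -
  have "{n. even n} = UNIV - {n::nat. odd n}" by auto
  then show ?thesis
    using has_sum_Diff[OF lambert_series_has_sum[OF assms] lambert_series_odd_indices[OF assms]] by simp
qed

text \<open>At an odd exponent, with \<open>Y = y ^ Suc n\<close>, the two terms combine by
  \<open>Y / (1 - Y) - Y / (1 + Y) = 2 * Y\<^sup>2 / (1 - Y\<^sup>2)\<close> into a term of the
  series at \<open>y\<^sup>2\<close>. At even exponents the two series agree.\<close>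

lemma lambert_series_add_minus:
  assumes "norm y < 1"
  shows "lambert_series y (- of_nat p) + lambert_series (- y) (- of_nat p) =
    2 * (1 + 1 / 2 ^ p) * lambert_series (y\<^sup>2) (- of_nat p) - 2 / 2 ^ p * lambert_series (y ^ 4) (- of_nat p)"
proof -
  let ?L = "\<lambda>q. lambert_series q (- of_nat p)"
  let ?a = "\<lambda>y n. y ^ Suc n / (1 - y ^ Suc n) / of_nat (Suc n) ^ p :: complex"
  have y: "norm (- y) < 1" "norm (y\<^sup>2) < 1"
    using assms by (simp_all add: norm_power power_less_one_iff)
  have "((\<lambda>n. ?a y n + ?a (- y) n) has_sum
      (?L y - ?L (y\<^sup>2) / 2 ^ p) + (?L (- y) - ?L ((- y)\<^sup>2) / 2 ^ p)) {n. even n}"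
    by (intro has_sum_add lambert_series_even_indices assms y)
  moreover have "?a y n + ?a (- y) n = 2 * ?a (y\<^sup>2) n" if "n \<in> {n. even n}" for n
  proof -
    define Y where "Y = y ^ Suc n"
    have "norm Y < 1"
      unfolding Y_def norm_power using assms by (simp add: power_less_one_iff del: power_Suc)
    then have "Y \<noteq> 1" "Y \<noteq> - 1" by auto
    then have nz: "1 - Y \<noteq> 0" "1 + Y \<noteq> 0" by (auto simp: add_eq_0_iff)
    have eqs: "(- y) ^ Suc n = - Y" "(y\<^sup>2) ^ Suc n = Y * Y"
      using that by (simp_all add: Y_def power_minus_odd power2_eq_square flip: power_mult_distrib)
    have "1 - Y * Y = (1 - Y) * (1 + Y)" by (simp add: algebra_simps)
    then have "Y / (1 - Y) + - Y / (1 - - Y) = 2 * (Y * Y / (1 - Y * Y))"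
      using nz by (simp add: divide_simps) (simp add: algebra_simps)
    from arg_cong[OF this, of "\<lambda>x. x / of_nat (Suc n) ^ p"] show ?thesis
      unfolding eqs Y_def[symmetric] by (simp only: add_divide_distrib times_divide_eq_right)
  qed
  ultimately have "((\<lambda>n. 2 * ?a (y\<^sup>2) n) has_sum
      (?L y - ?L (y\<^sup>2) / 2 ^ p) + (?L (- y) - ?L ((- y)\<^sup>2) / 2 ^ p)) {n. even n}"
    by (subst (asm) has_sum_cong) auto
  moreover have "((\<lambda>n. 2 * ?a (y\<^sup>2) n) has_sum 2 * (?L (y\<^sup>2) - ?L ((y\<^sup>2)\<^sup>2) / 2 ^ p)) {n. even n}"
    by (intro has_sum_cmult_right lambert_series_even_indices y)
  ultimately have "(?L y - ?L (y\<^sup>2) / 2 ^ p) + (?L (- y) - ?L ((- y)\<^sup>2) / 2 ^ p) =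
      2 * (?L (y\<^sup>2) - ?L ((y\<^sup>2)\<^sup>2) / 2 ^ p)"
    by (rule has_sum_unique)
  moreover have "(y\<^sup>2)\<^sup>2 = y ^ 4" by simp
  ultimately show ?thesis
    by (simp add: algebra_simps)
qed

section \<open>The point on the unit circle\<close>

lemma sum_atMost_double_pairing:
  fixes f :: "nat \<Rightarrow> 'a :: comm_monoid_add"
  shows "(\<Sum>i\<le>2 * k. f i) = f k + (\<Sum>j<k. f j + f (2 * k - j))"
proof -
  have "{..2 * k} = insert k ({..<k} \<union> {k<..2 * k})" by auto
  then have "(\<Sum>i\<le>2 * k. f i) = (\<Sum>i<k. f i) + f k + (\<Sum>i\<in>{k<..2 * k}. f i)"
    by simp (subst sum.union_disjoint; auto simp: ac_simps)
  also have "(\<Sum>i\<in>{k<..2 * k}. f i) = (\<Sum>j<k. f (2 * k - j))"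
    by (rule sum.reindex_bij_witness[of _ "\<lambda>j. 2 * k - j" "\<lambda>j. 2 * k - j"]) auto
  finally show ?thesis by (simp add: sum.distrib ac_simps)
qed

lemma cos_even_multiple_ne_minus_1:
  assumes "sin \<theta> = 1 / (4 :: real)"
  shows "cos (2 * real (Suc n) * \<theta>) \<noteq> - 1"
proof -
  \<comment> \<open>\<open>u n\<close> is an odd integer for \<open>n \<ge> 1\<close>, whereas the value \<open>-1\<close> of the cosine would make it even.\<close>
  define u where "u n = 2 * 4 ^ n * cos (2 * real n * \<theta>)" for n
  have c1: "cos (2 * \<theta>) = 7 / 8"
    unfolding cos_double_sin assms by (simp add: power2_eq_square)
  \<comment> \<open>The cosine recurrence has coefficient
    \<open>2 * cos (2 * \<theta>) = 7 / 4\<close>; the scaling by 4 per index gives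
    \<open>7 = 4 * 7 / 4\<close> and \<open>16 = 4 ^ 2\<close>.\<close>
  have rec: "u (Suc (Suc n)) = 7 * u (Suc n) - 16 * u n" for n
  proof -
    have "cos (2 * real (Suc (Suc n)) * \<theta>) + cos (2 * real n * \<theta>) =
        2 * cos (2 * real (Suc n) * \<theta>) * cos (2 * \<theta>)"
      using cos_plus_cos[of "2 * real (Suc (Suc n)) * \<theta>" "2 * real n * \<theta>"]
      by (simp add: algebra_simps add_divide_distrib diff_divide_distrib)
    then have "cos (2 * real (Suc (Suc n)) * \<theta>) = 7 / 4 * cos (2 * real (Suc n) * \<theta>) - cos (2 * real n * \<theta>)"
      unfolding c1 by simp
    moreover have "2 * (4 * (4 * P)) * (7 / 4 * a - b) = 7 * (2 * (4 * P) * a) - 16 * (2 * P * b)"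
      for P a b :: real
      by (simp add: algebra_simps)
    ultimately show ?thesis
      unfolding u_def power_Suc by (simp only:)
  qed
  \<comment> \<open>The induction starts at index 1 because \<open>u 0 = 2\<close> is even. Two
    consecutive values are carried for the recurrence, and \<open>7 * b - 16 * a\<close> inherits
    the parity of \<open>b\<close>.\<close>
  have "\<exists>a b :: int. odd a \<and> u (Suc n) = of_int a \<and> u (Suc (Suc n)) = of_int b \<and> odd b" for n
  proof (induction n)
    case 0
    have "u 1 = of_int 7" "u 0 = 2" by (simp_all add: u_def c1)
    moreover from this have "u (Suc (Suc 0)) = of_int 17"
      using rec[of 0] by simp
    ultimately show ?case
      by (intro exI[of _ 7] exI[of _ 17]) simp
  next
    case (Suc n)
    then obtain a b where ab: "odd a" "odd b" "u (Suc n) = of_int a" "u (Suc (Suc n)) = of_int b"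
      by blast
    then have "u (Suc (Suc (Suc n))) = of_int (7 * b - 16 * a)"
      using rec[of "Suc n"] by simp
    then show ?case
      using ab by (intro exI[of _ b] exI[of _ "7 * b - 16 * a"]) simp
  qed
  then obtain a :: int where a: "odd a" "u (Suc n) = of_int a" by blast
  show ?thesis
  proof
    assume "cos (2 * real (Suc n) * \<theta>) = - 1"
    then have "of_int a = (of_int (- 2 * 4 ^ Suc n) :: real)"
      unfolding a(2)[symmetric] u_def by simp
    then have "a = - 2 * 4 ^ Suc n"
      by (simp only: of_int_eq_iff)
    with a(1) show False by simp
  qed
qed

text \<open>The summands at \<open>j\<close> and \<open>2 * k - j\<close> have equal coefficients,
  and their powers are conjugate after \<open>cis \<psi> ^ (2 * k)\<close> is factored out, which
  leaves twice a cosine. The middle summand is unpaired; hence the halving at \<open>j = k\<close>,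
  the Kronecker delta in \<open>coeff_c\<close>.\<close>

lemma sum_cis_pairing:
  fixes b :: "nat \<Rightarrow> real" and \<psi> :: real
  shows "(\<Sum>i\<le>2 * k. of_real (b i) * of_real (b (2 * k - i)) * cis \<psi> ^ (2 * i)) =
    cis \<psi> ^ (2 * k) * of_real (\<Sum>j=0..k. 2 * cos ((2 * real k - 2 * real j) * \<psi>)
       / (1 + (if j = k then 1 else 0)) * (b j * b (2 * k - j)))"
proof -
  let ?f = "\<lambda>i. of_real (b i) * of_real (b (2 * k - i)) * cis \<psi> ^ (2 * i)"
  let ?g = "\<lambda>j. 2 * cos ((2 * real k - 2 * real j) * \<psi>) / (1 + (if j = k then 1 else 0)) * (b j * b (2 * k - j))"
  have "?f j + ?f (2 * k - j) = cis \<psi> ^ (2 * k) * of_real (?g j)" if "j < k" for j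
  proof -
    define n where "n = 2 * (k - j)"
    have n: "real n = 2 * real k - 2 * real j" "2 * k = 2 * j + n" "2 * (2 * k - j) = 2 * j + n + n" "2 * k - (2 * k - j) = j"
      using that by (auto simp: n_def)
    have cis_n: "cis (n * \<psi>) = cis \<psi> ^ n"
      by (rule Complex.DeMoivre [symmetric])
    have e2k: "cis \<psi> ^ (2 * k) = cis \<psi> ^ (2 * j) * cis (n * \<psi>)"
      unfolding n(2) power_add cis_n by (rule refl)
    have "complex_of_real (2 * cos (n * \<psi>)) = cis (- (n * \<psi>)) + cis (n * \<psi>)"
      by (simp add: complex_eq_iff)
    then have "cis \<psi> ^ (2 * k) * of_real (2 * cos (n * \<psi>)) =
        cis \<psi> ^ (2 * j) * cis (n * \<psi>) * (cis (- (n * \<psi>)) + cis (n * \<psi>))"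
      unfolding e2k by (simp only:)
    also have "cis \<psi> ^ (2 * j) * cis (n * \<psi>) * (cis (- (n * \<psi>)) + cis (n * \<psi>)) =
        cis \<psi> ^ (2 * j) + cis \<psi> ^ (2 * j) * cis (n * \<psi>) * cis (n * \<psi>)"
      by (simp add: distrib_left mult.assoc cis_mult)
    also have "cis \<psi> ^ (2 * j) * cis (n * \<psi>) * cis (n * \<psi>) = cis \<psi> ^ (2 * (2 * k - j))"
      unfolding n(3) power_add cis_n by (rule refl)
    finally have "cis \<psi> ^ (2 * j) + cis \<psi> ^ (2 * (2 * k - j)) = cis \<psi> ^ (2 * k) * of_real (2 * cos (n * \<psi>))"
      by (rule sym)
    then have "of_real (b j) * of_real (b (2 * k - j)) * (cis \<psi> ^ (2 * j) + cis \<psi> ^ (2 * (2 * k - j))) =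
        of_real (b j) * of_real (b (2 * k - j)) * (cis \<psi> ^ (2 * k) * of_real (2 * cos (n * \<psi>)))"
      by (rule arg_cong)
    then show ?thesis
      using that unfolding n(4) by (simp add: n(1) algebra_simps)
  qed
  then have "(\<Sum>i\<le>2 * k. ?f i) = cis \<psi> ^ (2 * k) * of_real (?g k + (\<Sum>j<k. ?g j))"
    unfolding sum_atMost_double_pairing by (simp add: distrib_left sum_distrib_left mult_2[symmetric] del: of_real_mult) (simp add: mult_ac)
  also have "?g k + (\<Sum>j<k. ?g j) = (\<Sum>j=0..k. ?g j)"
    unfolding atLeast0AtMost lessThan_Suc_atMost[symmetric] by simp
  finally show ?thesis .
qed

text \<open>As \<open>4 * sin \<theta> = 1\<close>, the addition formulas around \<open>x\<close>
  merge the numerator into \<open>- 2 * sin (2 * \<alpha>)\<close>. Where the cosine vanishes, both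
  quotients are 0.\<close>

lemma coeff_a_eq:
  assumes "sin \<theta> = 1 / 4"
  shows "coeff_a \<theta> k = - tan ((2 * real k - 1) * \<theta>)"
proof -
  define \<alpha> where "\<alpha> = (2 * real k - 1) * \<theta>"
  define x where "x = (4 * real k - 1) * \<theta>"
  have eqs: "4 * real k * \<theta> = x + \<theta>" "2 * \<alpha> = x - \<theta>"
    by (simp_all add: x_def \<alpha>_def algebra_simps)
  have "cos x - 2 * sin (4 * real k * \<theta>) = - 2 * sin (2 * \<alpha>)"
    unfolding eqs sin_add sin_diff assms by simp
  then show ?thesis
    unfolding coeff_a_def x_def[symmetric] \<alpha>_def[symmetric]
    by (simp add: sin_double tan_def power2_eq_square)
qed

text \<open>Again by \<open>4 * sin \<theta> = 1\<close>, the summand \<open>sin x\<close> changes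
  \<open>2 * cos (x + \<theta>)\<close> into \<open>2 * cos (x - \<theta>)\<close>, and the
  numerator becomes the denominator.\<close>

lemma coeff_b_eq_1:
  assumes "sin \<theta> = 1 / 4" "cos ((2 * real k - 1) * \<theta>) \<noteq> 0"
  shows "coeff_b \<theta> k = 1"
proof -
  define \<alpha> where "\<alpha> = (2 * real k - 1) * \<theta>"
  define x where "x = (4 * real k - 1) * \<theta>"
  have eqs: "4 * real k * \<theta> = x + \<theta>" "2 * \<alpha> = x - \<theta>"
    by (simp_all add: x_def \<alpha>_def algebra_simps)
  have "2 + 2 * cos (4 * real k * \<theta>) + sin x = 2 + 2 * cos (2 * \<alpha>)"
    unfolding eqs cos_add cos_diff assms(1) by simp
  also have "\<dots> = 4 * (cos \<alpha>)\<^sup>2"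
    by (simp add: cos_double_cos)
  finally show ?thesis
    unfolding coeff_b_def x_def[symmetric] \<alpha>_def[symmetric]
    using assms(2) by (simp add: \<alpha>_def)
qed

theorem theorem5p3:
  fixes \<theta> :: real and k :: nat
  assumes "0 < \<theta>" and "\<theta> < pi / 2" and "cot \<theta> = sqrt 15"
    and "k \<ge> 1"
  shows "zeta (of_int (4 * int k - 1)) =
      of_real ((2 * pi) ^ (4 * k - 1) *
        (\<Sum>j=0..k. (-1) ^ (j + 1) * coeff_c \<theta> j k * bernoulli (2 * j) * bernoulli (4 * k - 2 * j)
                    / (fact (2 * j) * fact (4 * k - 2 * j))))
    + of_real (coeff_a \<theta> k) * lambert_S (exp (- sqrt 15 * pi)) (of_int (- 4 * int k + 1))
    + (2 powi (- 4 * int k + 2) + 2) * of_real (coeff_b \<theta> k)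
        * lambert_series (of_real (exp (- sqrt 15 * pi))) (of_int (- 4 * int k + 1))
    - (2 powi (- 8 * int k + 4) + 3 * 2 powi (- 4 * int k + 2) + 4) * of_real (coeff_b \<theta> k)
        * lambert_series (of_real (exp (- 2 * sqrt 15 * pi))) (of_int (- 4 * int k + 1))
    + (2 powi (- 8 * int k + 4) + 2 powi (- 4 * int k + 3)) * of_real (coeff_b \<theta> k)
        * lambert_series (of_real (exp (- 4 * sqrt 15 * pi))) (of_int (- 4 * int k + 1))"
proof -
  define m p where "m = 2 * k - 1" and "p = 4 * k - 1"
  have m: "m \<ge> 1" "2 * m + 1 = p" "m + 1 = 2 * k" "2 * m + 2 = 4 * k" "real m = 2 * real k - 1"
    using assms(4) by (simp_all add: m_def p_def of_nat_diff)
  \<comment> \<open>\<open>\<alpha>\<close> is the angle in the denominators and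
    \<open>\<psi>\<close> the argument of \<open>t\<close>; \<open>\<epsilon>\<close> is the sign
    from reducing \<open>m * \<psi>\<close> to \<open>\<alpha>\<close>.\<close>
  define \<alpha> \<psi> where "\<alpha> = (2 * real k - 1) * \<theta>" and "\<psi> = pi / 2 - \<theta>"
  define \<epsilon> :: real where "\<epsilon> = (-1) ^ (k + 1)"

  have s_pos: "sin \<theta> > 0"
    using assms(1,2) by (intro sin_gt_zero) auto
  then have c: "cos \<theta> = sqrt 15 * sin \<theta>"
    using assms(3) by (simp add: cot_def field_simps)
  have "16 * (sin \<theta>)\<^sup>2 = 1"
    using sin_cos_squared_add[of \<theta>] unfolding c by (simp add: power_mult_distrib)
  then have "(sin \<theta>)\<^sup>2 = (1 / 4)\<^sup>2"
    by (simp add: power2_eq_square)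
  then have sin_\<theta>: "sin \<theta> = 1 / 4"
    using s_pos by (simp add: power2_eq_iff)
  then have cos_\<theta>: "cos \<theta> = sqrt 15 / 4"
    using c by simp

  \<comment> \<open>A zero would make \<open>cos (2 * \<alpha>)\<close> equal to -1, which is
    excluded for even multiples of \<theta>; here \<open>Suc (2 * k - 2)\<close> is
    \<open>2 * k - 1\<close>.\<close>
  have cos_\<alpha>: "cos \<alpha> \<noteq> 0"
  proof
    assume "cos \<alpha> = 0"
    then have "cos (2 * \<alpha>) = - 1"
      by (simp add: cos_double_cos)
    moreover have "2 * \<alpha> = 2 * real (Suc (2 * k - 2)) * \<theta>"
      using assms(4) by (simp add: \<alpha>_def of_nat_diff algebra_simps)
    ultimately show False
      using cos_even_multiple_ne_minus_1[OF sin_\<theta>] by metis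
  qed

  \<comment> \<open>The point \<open>t\<close> and the arguments \<open>y\<close> and
    \<open>- y\<close>\<close>
  define y :: complex where "y = \<i> * of_real (sqrt (exp (- sqrt 15 * pi)))"
  have sqrt_exp: "sqrt (exp (- sqrt 15 * pi)) = exp (- (sqrt 15 * pi / 2))"
    by (rule real_sqrt_unique) (simp_all flip: exp_double)
  define t where "t = cis \<psi>"
  have t_alt: "t = Complex (1 / 4) (sqrt 15 / 4)"
    by (simp add: t_def \<psi>_def complex_eq_iff cos_diff sin_diff sin_\<theta> cos_\<theta>)
  have t0: "t \<noteq> 0"
    by (simp add: t_def)
  \<comment> \<open>\<open>t\<close> is a root of \<open>t\<^sup>2 - t / 2 + 1\<close>. The shift by
    \<open>1 / 2\<close> multiplies the exponential by
    \<open>exp (- \<i> * pi) = - 1\<close>.\<close>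
  have t_inv: "- 1 / t = t - 1 / 2"
  proof -
    have "t * (t - 1 / 2) = - 1"
      by (simp add: t_alt complex_eq_iff)
    then show ?thesis using t0 by (metis nonzero_mult_div_cancel_left)
  qed
  have "2 * \<i> * (pi * t) = of_real (- (sqrt 15 * pi / 2)) + \<i> * of_real (pi / 2)"
    by (simp add: t_alt complex_eq_iff)
  then have y_t: "exp (2 * \<i> * (pi * t)) = y"
    unfolding y_def sqrt_exp
    by (simp only: exp_add exp_of_real cis_conv_exp [symmetric] cis_pi_half mult.commute)
  have "2 * \<i> * (pi * (- 1 / t)) = 2 * \<i> * (pi * t) - \<i> * pi"
    unfolding t_inv by (simp add: algebra_simps)
  then have "exp (2 * \<i> * (pi * (- 1 / t))) = exp (2 * \<i> * (pi * t)) / exp (\<i> * pi)"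
    by (simp only: exp_diff)
  then have y_t': "exp (2 * \<i> * (pi * (- 1 / t))) = - y"
    unfolding y_t exp_pi_i' by simp
  have Im_t: "Im t > 0" "Im (- 1 / t) > 0"
    unfolding t_inv by (simp_all add: t_alt)
  have norm_y: "norm y < 1"
    unfolding y_def sqrt_exp by (simp add: norm_mult)
  define q :: complex where "q = of_real (exp (- sqrt 15 * pi))"
  have q: "norm q < 1" "y\<^sup>2 = - q" "y ^ 4 = q\<^sup>2"
  proof -
    show "norm q < 1" by (simp add: q_def)
    show "y\<^sup>2 = - q"
      by (simp add: y_def q_def power_mult_distrib flip: of_real_power)
    then show "y ^ 4 = q\<^sup>2"
      by (metis mult_2 numeral_Bit0 power2_eq_square power_add minus_mult_minus numeral_plus_numeral)
  qed
  have q_pow: "q\<^sup>2 = of_real (exp (- 2 * sqrt 15 * pi))" "q ^ 4 = of_real (exp (- 4 * sqrt 15 * pi))"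
    unfolding q_def of_real_power [symmetric] exp_of_nat_mult [symmetric] by simp_all

  \<comment> \<open>Reduction of the Lambert series to \<open>q\<close>, \<open>q\<^sup>2\<close>,
    \<open>q ^ 4\<close>\<close>
  define L where "L = (\<lambda>x. lambert_series x (- of_nat p))"
  define A D where "A = L y + L (- y)" and "D = L y - L (- y)"
  define h :: complex where "h = 1 / 2 ^ p"
  define Z where "Z = zeta (of_nat p)"
  \<comment> \<open>The parity relation is used at \<open>q\<close> and at \<open>y\<close>, where
    \<open>y\<^sup>2 = - q\<close>; eliminating \<open>L (- q)\<close> gives the formula for
    \<open>A\<close>.\<close>
  have "L q + L (- q) = 2 * (1 + h) * L (q\<^sup>2) - 2 * h * L (q ^ 4)"
    using lambert_series_add_minus[OF q(1), of p] by (simp add: L_def h_def)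
  moreover have "A = 2 * (1 + h) * L (- q) - 2 * h * L (q\<^sup>2)"
    using lambert_series_add_minus[OF norm_y, of p] unfolding q by (simp add: A_def L_def h_def)
  ultimately have A: "A = - (2 * (1 + h)) * L q + (4 * h\<^sup>2 + 6 * h + 4) * L (q\<^sup>2) - (4 * h\<^sup>2 + 4 * h) * L (q ^ 4)"
    by algebra

  define b where "b j = bernoulli (2 * j) / fact (2 * j)" for j
  define R where "R = (\<Sum>j=0..k. 2 * cos ((2 * real k - 2 * real j) * \<psi>)
       / (1 + (if j = k then 1 else 0)) * (b j * b (2 * k - j)))"
  define Q where "Q = (\<Sum>j=0..k. (-1) ^ (j + 1) * coeff_c \<theta> j k * bernoulli (2 * j) * bernoulli (4 * k - 2 * j)
                    / (fact (2 * j) * fact (4 * k - 2 * j)))"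
  \<comment> \<open>Since \<open>\<psi> = pi / 2 - \<theta>\<close>, passing from
    \<open>\<psi>\<close> to \<open>\<theta>\<close> yields the sign \<open>(-1) ^ (k - j)\<close>;
    the factor \<open>cos \<alpha>\<close> clears the denominator of \<open>coeff_c\<close>.\<close>
  have R: "R = 2 * \<epsilon> * cos \<alpha> * Q"
    unfolding R_def Q_def sum_distrib_left
  proof (rule sum.cong)
    fix j assume "j \<in> {0..k}"
    define n where "n = k - j"
    have n: "k = j + n" "2 * (2 * k - j) = 4 * k - 2 * j"
      using \<open>j \<in> {0..k}\<close> by (auto simp: n_def)
    have ang: "(2 * real k - 2 * real j) * \<psi> = real n * pi - (2 * real k - 2 * real j) * \<theta>"
      by (simp add: n(1) \<psi>_def algebra_simps)
    have sgn: "\<epsilon> * (-1) ^ (j + 1) = (-1) ^ n"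
      unfolding \<epsilon>_def n(1) by (simp add: power_add)
    have "2 * \<epsilon> * cos \<alpha> * ((-1) ^ (j + 1) * coeff_c \<theta> j k * bernoulli (2 * j) * bernoulli (4 * k - 2 * j)
          / (fact (2 * j) * fact (4 * k - 2 * j))) =
        2 * (\<epsilon> * (-1) ^ (j + 1)) * (cos \<alpha> * coeff_c \<theta> j k) * (b j * b (2 * k - j))"
      by (simp add: b_def n(2))
    also have "cos \<alpha> * coeff_c \<theta> j k = cos ((2 * real k - 2 * real j) * \<theta>) / (1 + (if j = k then 1 else 0))"
      using cos_\<alpha> unfolding coeff_c_def \<alpha>_def by simp
    also have "2 * (\<epsilon> * (-1) ^ (j + 1)) * (cos ((2 * real k - 2 * real j) * \<theta>) / (1 + (if j = k then 1 else 0)))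
        = 2 * cos ((2 * real k - 2 * real j) * \<psi>) / (1 + (if j = k then 1 else 0))"
      unfolding ang sgn by (simp add: cos_diff)
    finally show "2 * cos ((2 * real k - 2 * real j) * \<psi>) / (1 + (if j = k then 1 else 0)) * (b j * b (2 * k - j)) =
        2 * \<epsilon> * cos \<alpha> * ((-1) ^ (j + 1) * coeff_c \<theta> j k * bernoulli (2 * j) * bernoulli (4 * k - 2 * j)
          / (fact (2 * j) * fact (4 * k - 2 * j)))"
      by (rule sym)
  qed simp

  \<comment> \<open>The transformation formula at \<open>t\<close>, solved for the zeta
    value\<close>
  define P T where "P = complex_of_real pi" and "T = complex_of_real ((2 * pi) ^ p)"
  define C S where "C = complex_of_real (cos (m * \<psi>))" and "S = complex_of_real (sin (m * \<psi>))"
  have tm: "t ^ m = C + \<i> * S"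
    unfolding t_def Complex.DeMoivre C_def S_def by (simp add: complex_eq_iff)
  have CS: "C\<^sup>2 + S\<^sup>2 = 1"
    unfolding C_def S_def by (simp flip: of_real_power of_real_add)
  define Wp Wm where "Wp = Z + 2 * L y" and "Wm = Z + 2 * L (- y)"
  have cot_t: "cot_series m t = - \<i> * pi * Wp"
    using cot_series_eq_lambert_series[OF Im_t(1) m(1)] unfolding y_t m(2) Wp_def Z_def L_def .
  have cot_t': "cot_series m (- 1 / t) = - \<i> * pi * Wm"
    using cot_series_eq_lambert_series[OF Im_t(2) m(1)] unfolding y_t' m(2) Wm_def Z_def L_def .
  have "t * (- \<i> * pi * Wp - t ^ (2 * m) * (- \<i> * pi * Wm)) =
      - ((2 * pi * \<i>) ^ (4 * k)) / 2 * (\<Sum>i\<le>2 * k. of_real (b i) * of_real (b (2 * k - i)) * t ^ (2 * i))"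
    using ramanujan_bernoulli[of t m] Im_t(1) m(1) unfolding cot_t cot_t' m(3,4) b_def by simp
  also have "(\<Sum>i\<le>2 * k. of_real (b i) * of_real (b (2 * k - i)) * t ^ (2 * i)) = t ^ (m + 1) * of_real R"
    unfolding t_def sum_cis_pairing R_def m(3) ..
  also have "(2 * pi * \<i>) ^ (4 * k) = 2 * P * T"
  proof -
    have "4 * k = Suc p" using assms(4) by (simp add: p_def)
    then have "complex_of_real (2 * pi) ^ (4 * k) = 2 * P * T"
      by (simp add: P_def T_def)
    moreover have "\<i> ^ (4 * k) = 1" by (simp add: power_mult power4_eq_xxxx)
    ultimately show ?thesis
      by (simp only: power_mult_distrib [of _ "\<i>"] mult_1_right)
  qed
  finally have "t * (- \<i> * P * (Wp - t ^ m * t ^ m * Wm)) = t * (- P * (T * (t ^ m * of_real R)))"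
    by (simp add: P_def [symmetric] algebra_simps power_mult power2_eq_square)
  then have "P * (\<i> * (Wp - t ^ m * t ^ m * Wm)) = P * (T * (t ^ m * of_real R))"
    using t0 by simp
  then have "\<i> * (Wp - t ^ m * t ^ m * Wm) = T * (t ^ m * of_real R)"
    by (simp add: P_def)
  \<comment> \<open>On the unit circle \<open>C - \<i> * S\<close> inverts \<open>t ^ m\<close>.
    Multiplying by it makes the relation symmetric in \<open>Wp\<close> and \<open>Wm\<close>, so
    that only \<open>A\<close> and \<open>D\<close> enter.\<close>
  then have "(C - \<i> * S) * (\<i> * (Wp - (C + \<i> * S) * (C + \<i> * S) * Wm)) =
      (C - \<i> * S) * (T * ((C + \<i> * S) * of_real R))"
    unfolding tm by simp
  moreover have unit: "(C - \<i> * S) * (C + \<i> * S) = 1"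
    using CS by (simp add: algebra_simps power2_eq_square)
  ultimately have "\<i> * ((C - \<i> * S) * Wp - (C + \<i> * S) * Wm) = T * of_real R"
    using i_squared by algebra
  then have core: "2 * S * (Z + A) + 2 * \<i> * C * D = T * of_real R"
    unfolding Wp_def Wm_def A_def D_def using i_squared by algebra

  have ang: "m * \<psi> = real k * pi - (pi / 2 + \<alpha>)"
    unfolding m(5) \<psi>_def \<alpha>_def by (simp add: algebra_simps)
  have "S = of_real (\<epsilon> * cos \<alpha>)" "C = of_real (\<epsilon> * sin \<alpha>)"
    unfolding S_def C_def ang \<epsilon>_def by (simp_all add: sin_diff cos_diff sin_add cos_add)
  with core have "2 * \<epsilon> * (cos \<alpha> * (Z + A) + \<i> * sin \<alpha> * D) = 2 * \<epsilon> * (cos \<alpha> * (T * of_real Q))"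
    unfolding R by (simp add: algebra_simps)
  moreover have "complex_of_real \<epsilon> \<noteq> 0"
    by (simp add: \<epsilon>_def)
  ultimately have "cos \<alpha> * (Z + A) + \<i> * sin \<alpha> * D = cos \<alpha> * (T * of_real Q)"
    by simp
  \<comment> \<open>Division by \<open>cos \<alpha>\<close> gives the coefficient
    \<open>- tan \<alpha>\<close>, which is \<open>coeff_a\<close>; the factor
    \<open>\<i> * D\<close> is the series \<open>lambert_S\<close>.\<close>
  then have Z: "Z = T * of_real Q - tan \<alpha> * (\<i> * D) - A"
    using cos_\<alpha> by (simp add: tan_def field_simps)

  \<comment> \<open>All powers of 2 in the statement are expressed by
    \<open>h = 2 powi (1 - 4 * int k)\<close>, matching the coefficients of
    \<open>- A\<close>.\<close>
  have pw: "(2 :: complex) powi (- 4 * int k + 2) = 2 * h"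
           "(2 :: complex) powi (- 4 * int k + 3) = 4 * h"
           "(2 :: complex) powi (- 8 * int k + 4) = 4 * h\<^sup>2"
  proof -
    have h: "h = 2 powi (- int p)"
      by (simp add: h_def power_int_minus field_simps)
    have add: "(2 :: complex) powi (a + b) = 2 powi a * 2 powi b" for a b
      by (rule power_int_add) simp
    have e: "- 4 * int k + 2 = 1 + - int p" "- 4 * int k + 3 = 2 + - int p" "- 8 * int k + 4 = 2 + (- int p + - int p)"
      using assms(4) by (simp_all add: p_def of_nat_diff)
    show "(2 :: complex) powi (- 4 * int k + 2) = 2 * h" "(2 :: complex) powi (- 4 * int k + 3) = 4 * h"
         "(2 :: complex) powi (- 8 * int k + 4) = 4 * h\<^sup>2"
      unfolding e h add power2_eq_square by simp_all
  qed
  have s: "(of_int (- 4 * int k + 1) :: complex) = - of_nat p" "(of_int (4 * int k - 1) :: complex) = of_nat p"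
    using assms(4) by (simp_all add: p_def of_nat_diff)
  have S: "lambert_S (exp (- sqrt 15 * pi)) (- of_nat p) = \<i> * D"
    unfolding lambert_S_def D_def L_def y_def by simp
  show ?thesis
    unfolding s S pw coeff_a_eq[OF sin_\<theta>] coeff_b_eq_1[OF sin_\<theta> cos_\<alpha>[unfolded \<alpha>_def]]
      q_pow[symmetric] q_def[symmetric] \<alpha>_def[symmetric] Q_def[symmetric] p_def[symmetric]
      L_def[symmetric] fun_cong[OF L_def, symmetric] Z_def[symmetric]
    unfolding Z A by (simp add: T_def algebra_simps)
qed

end
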